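(* Let $\mathbb{T}$ be a time scale, let $a,b\in\mathbb{T}$ with $a<b$, let $f:[a,b]\to\mathbb{R}$ be differentiable, and put $M=\sup_{a<x<b}|f^\Delta(x)|$. Suppose that $x\in[a,b]\cap\mathbb{T}$, $\alpha_1\in[a,x]\cap\mathbb{T}$ and $\alpha_2\in[x,b]\cap\mathbb{T}$. Then we have the sharp inequality on time scales $$\left|\int_a^b f^\sigma(t)\,\Delta t-\Big((\alpha_1-a)f(a)+(\alpha_2-\alpha_1)f(x)+(b-\alpha_2)f(b)\Big)\right|\le M\Big(h_2(a,\alpha_1)+h_2(x,\alpha_1)+h_2(x,\alpha_2)+h_2(b,\alpha_2)\Big).$$
   Context: A time scale $\mathbb{T}$ is an arbitrary nonempty closed subset of $\mathbb{R}$. An interval means the intersection of the real interval with $\mathbb{T}$. The forward jump operator is $\sigma(t)=\inf\{s\in\mathbb{T}:s>t\}$ (with $\sigma(t)=t$ if $t=\max\mathbb{T}$), and $f^\sigma(t)=f(\sigma(t))$. If $\mathbb{T}$ has a left-scattered maximum $m$ (i.e. $\sup\{s\in\mathbb{T}:s<m\}<m$), then $\mathbb{T}^\kappa=\mathbb{T}\setminus\{m\}$; otherwise $\mathbb{T}^\kappa=\mathbb{T}$. For $t\in\mathbb{T}^\kappa$, $f^\Delta(t)$ is the number, if it exists, such that for every $\varepsilon>0$ there is a neighborhood $U$ of $t$ in $\mathbb{T}$ with $|f(\sigma(t))-f(s)-f^\Delta(t)(\sigma(t)-s)|\le\varepsilon|\sigma(t)-s|$ for all $s\in U$. Differentiable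 means $\Delta$-differentiable, i.e. $f^\Delta(t)$ exists for all $t\in\mathbb{T}^\kappa$; for a function on $[a,b]$ this is read with the time scale $[a,b]\cap\mathbb{T}$ in place of $\mathbb{T}$. $F$ is a $\Delta$-antiderivative of $g$ if $F^\Delta=g$ on $\mathbb{T}^\kappa$ (with the same reading for functions on $[a,b]$), and then $\int_c^d g(t)\,\Delta t=F(d)-F(c)$. Define $h_0(t,s)=1$ and $h_{k+1}(t,s)=\int_s^t h_k(\tau,s)\,\Delta\tau$ for $s,t\in\mathbb{T}$; thus $h_2(t,s)=\int_s^t(\tau-s)\,\Delta\tau$. "Sharp" is used in the sense that the right-hand side of the inequality cannot be replaced by a smaller one.
   Formalization: M is taken as the supremum of |f^Δ(t)| over a<t<b together with t=a when a is right-scattered; with the open interval alone the claim fails, e.g. T={0,1,2}, a=x=α₁=0, α₂=1, b=2, f(0)=1, f(1)=f(2)=0. *)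

theory Defs
  imports Complex_Main "HOL-Library.Extended_Real"
begin

definition time_scale :: "real set \<Rightarrow> bool" where
  "time_scale T \<longleftrightarrow> T \<noteq> {} \<and> closed T"

text \<open>
  In every notion below the time scale is an explicit parameter, so that the versions for
  functions on an interval arise by passing \<open>{a..b} \<inter> T\<close>. Functions are total on the reals, but
  only their values on the time scale matter.
\<close>

definition fwd_jump :: "real set \<Rightarrow> real \<Rightarrow> real" where
  "fwd_jump T t = (if {s\<in>T. t < s} = {} then t else Inf {s\<in>T. t < s})"

definition bwd_jump :: "real set \<Rightarrow> real \<Rightarrow> real" where
  "bwd_jump T t = (if {s\<in>T. s < t} = {} then t else Sup {s\<in>T. s < t})"

definition kappa :: "real set \<Rightarrow> real set" where
  "kappa T = T - {m\<in>T. (\<forall>s\<in>T. s \<le> m) \<and> bwd_jump T m < m}"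

definition has_delta_derivative ::
    "real set \<Rightarrow> (real \<Rightarrow> real) \<Rightarrow> real \<Rightarrow> real \<Rightarrow> bool" where
  "has_delta_derivative T f D t \<longleftrightarrow>
     (\<forall>\<epsilon>>0. \<exists>U. open U \<and> t \<in> U \<and>
        (\<forall>s\<in>U \<inter> T. \<bar>f (fwd_jump T t) - f s - D * (fwd_jump T t - s)\<bar> \<le> \<epsilon> * \<bar>fwd_jump T t - s\<bar>))"

definition delta_deriv :: "real set \<Rightarrow> (real \<Rightarrow> real) \<Rightarrow> real \<Rightarrow> real" where
  "delta_deriv T f t = (THE D. has_delta_derivative T f D t)"

definition delta_differentiable :: "real set \<Rightarrow> (real \<Rightarrow> real) \<Rightarrow> bool" where
  "delta_differentiable T f \<longleftrightarrow> (\<forall>t\<in>kappa T. \<exists>D. has_delta_derivative T f D t)"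

definition delta_antiderivative ::
    "real set \<Rightarrow> (real \<Rightarrow> real) \<Rightarrow> (real \<Rightarrow> real) \<Rightarrow> bool" where
  "delta_antiderivative T g F \<longleftrightarrow> (\<forall>t\<in>kappa T. has_delta_derivative T F (g t) t)"

definition delta_integral ::
    "real set \<Rightarrow> real \<Rightarrow> real \<Rightarrow> (real \<Rightarrow> real) \<Rightarrow> real" where
  "delta_integral T c d g = (THE I. \<exists>F. delta_antiderivative T g F \<and> I = F d - F c)"

fun ts_h :: "real set \<Rightarrow> nat \<Rightarrow> real \<Rightarrow> real \<Rightarrow> real" where
  "ts_h T 0 t s = 1"
| "ts_h T (Suc k) t s = delta_integral T s t (\<lambda>\<tau>. ts_h T k \<tau> s)"

text \<open>
  The supremum \<open>M\<close> of \<open>\<bar>f\<^sup>\<Delta>\<bar>\<close> over \<open>a < t < b\<close>, possibly infinite. The point \<open>a\<close> is added to the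
  index set exactly when it is right-scattered: \<open>f\<^sup>\<Delta>(a)\<close> is then not controlled by the values of
  \<open>f\<^sup>\<Delta>\<close> on the open interval, and the inequality would fail for \<open>f\<close> equal to 1 at \<open>a\<close>
  and 0 elsewhere (with \<open>x = \<alpha>\<^sub>1 = a\<close> and \<open>\<alpha>\<^sub>2 = \<sigma>(a)\<close>, the supremum over \<open>a < t < b\<close> vanishes but
  the left-hand side is \<open>\<sigma>(a) - a\<close>).
\<close>

definition delta_deriv_sup ::
    "real set \<Rightarrow> real \<Rightarrow> real \<Rightarrow> (real \<Rightarrow> real) \<Rightarrow> ereal" where
  "delta_deriv_sup T a b f =
     (SUP t\<in>{t\<in>T. (a < t \<or> (t = a \<and> a < fwd_jump T a)) \<and> t < b}.
        ereal \<bar>delta_deriv ({a..b} \<inter> T) f t\<bar>)"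

end

theory Submission
  imports Defs "HOL-Analysis.Analysis"
begin

text \<open>
  Let \<open>c(u)\<close> be the least point of the time scale that is \<open>\<ge> u\<close>. For continuous \<open>f\<close> the delta
  integral of \<open>f\<^sup>\<sigma>\<close> is the ordinary integral of \<open>f \<circ> c\<close>, and \<open>h\<^sub>2(t,s)\<close> is the ordinary integral of
  \<open>\<bar>c(u) - t\<bar>\<close> between \<open>s\<close> and \<open>t\<close>. So the error of the quadrature rule is the sum of the integrals
  of \<open>f(c(u)) - f(p)\<close> over the four intervals \<open>[a,\<alpha>\<^sub>1]\<close>, \<open>[\<alpha>\<^sub>1,x]\<close>, \<open>[x,\<alpha>\<^sub>2]\<close>, \<open>[\<alpha>\<^sub>2,b]\<close> with
  \<open>p = a, x, x, b\<close>, and the inequality follows from the mean value theorem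
  \<open>\<bar>f(c(u)) - f(p)\<bar> \<le> M \<bar>c(u) - p\<bar>\<close>. Equality would hold for the zigzag function
  \<open>\<bar>t - x\<bar> - \<bar>t - \<alpha>\<^sub>1\<bar> - \<bar>t - \<alpha>\<^sub>2\<bar>\<close>, which need not be differentiable at the corners; sharpness
  is obtained by replacing \<open>\<bar>r\<bar>\<close> with \<open>sqrt (r\<^sup>2 + \<eta>\<^sup>2)\<close> and rescaling.
\<close>

section \<open>Forward jumps, right-dense and left-dense points\<close>

lemma fwd_jump_ge: "t \<le> fwd_jump T t"
  unfolding fwd_jump_def by (auto intro!: cInf_greatest)

lemma fwd_jump_le: "s \<in> T \<Longrightarrow> t < s \<Longrightarrow> fwd_jump T t \<le> s"
  unfolding fwd_jump_def by (auto intro!: cInf_lower bdd_belowI[of _ t])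

lemma fwd_jump_mem:
  assumes "closed T" "t \<in> T"
  shows "fwd_jump T t \<in> T"
proof (cases "{s\<in>T. t < s} = {}")
  case False
  have "Inf {s\<in>T. t < s} \<in> closure {s\<in>T. t < s}"
    by (rule closure_contains_Inf) (use False in \<open>auto intro!: bdd_belowI[of _ t]\<close>)
  also have "\<dots> \<subseteq> closure T" by (rule closure_mono) auto
  finally show ?thesis using False assms by (simp add: fwd_jump_def)
qed (use assms in \<open>auto simp: fwd_jump_def\<close>)

text \<open>The later point \<open>s\<close> rules out the default value of \<open>fwd_jump\<close>:
  at a maximum of \<open>T\<close> the jump is also a fixed point, but no points accumulate from the
  right.\<close>

lemma right_denseD:
  assumes "fwd_jump T t = t" "s \<in> T" "t < s" "t < r"
  shows "\<exists>v\<in>T. t < v \<and> v < r"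
proof (rule ccontr)
  assume "\<not> ?thesis"
  hence "r \<le> fwd_jump T t"
    unfolding fwd_jump_def using assms by (auto intro!: cInf_greatest)
  thus False using assms by simp
qed

lemma less_mem_kappa: "t \<in> T \<Longrightarrow> s \<in> T \<Longrightarrow> t < s \<Longrightarrow> t \<in> kappa T"
  unfolding kappa_def by force

text \<open>\<open>kappa\<close> removes a maximum exactly when it is left-scattered, so a maximum
  that survives is left-dense. The point \<open>s\<close> excludes the default value of
  \<open>bwd_jump\<close>.\<close>

lemma left_denseD:
  assumes "t \<in> kappa T" "\<And>v. v \<in> T \<Longrightarrow> v \<le> t" "s \<in> T" "s < t" "r < t"
  shows "\<exists>v\<in>T. r < v \<and> v < t"
proof (rule ccontr)
  assume neg: "\<not> ?thesis"
  have "bwd_jump T t \<le> max r s"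
    unfolding bwd_jump_def using assms neg by (auto intro!: cSup_least simp: not_less le_max_iff_disj)
  hence "bwd_jump T t < t" using assms by auto
  thus False using assms(1,2) by (auto simp: kappa_def)
qed

section \<open>Calculus of the delta derivative\<close>

lemma has_delta_derivativeE:
  assumes "has_delta_derivative T f D t" "0 < \<epsilon>"
  obtains \<delta> where "0 < \<delta>"
    "\<And>s. s \<in> T \<Longrightarrow> \<bar>s - t\<bar> < \<delta> \<Longrightarrow>
       \<bar>f (fwd_jump T t) - f s - D * (fwd_jump T t - s)\<bar> \<le> \<epsilon> * \<bar>fwd_jump T t - s\<bar>"
proof -
  obtain U where U: "open U" "t \<in> U" "\<forall>s\<in>U \<inter> T.
     \<bar>f (fwd_jump T t) - f s - D * (fwd_jump T t - s)\<bar> \<le> \<epsilon> * \<bar>fwd_jump T t - s\<bar>"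
    using assms(1)[unfolded has_delta_derivative_def, rule_format, OF assms(2)] by (elim exE conjE)
  obtain \<delta> where \<delta>: "\<delta> > 0" "\<And>s. dist s t < \<delta> \<Longrightarrow> s \<in> U"
    using U(1,2) unfolding open_dist by blast
  show ?thesis
  proof (rule that[OF \<delta>(1)])
    fix s assume "s \<in> T" "\<bar>s - t\<bar> < \<delta>"
    hence "s \<in> U \<inter> T" using \<delta>(2)[of s] by (simp add: dist_real_def)
    thus "\<bar>f (fwd_jump T t) - f s - D * (fwd_jump T t - s)\<bar> \<le> \<epsilon> * \<bar>fwd_jump T t - s\<bar>" by (rule bspec[OF U(3)])
  qed
qed

lemma has_delta_derivativeI:
  assumes "\<And>\<epsilon>. 0 < \<epsilon> \<Longrightarrow> \<exists>\<delta>>0. \<forall>s\<in>T. \<bar>s - t\<bar> < \<delta> \<longrightarrow>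
       \<bar>f (fwd_jump T t) - f s - D * (fwd_jump T t - s)\<bar> \<le> \<epsilon> * \<bar>fwd_jump T t - s\<bar>"
  shows "has_delta_derivative T f D t"
  unfolding has_delta_derivative_def
proof (intro allI impI)
  fix \<epsilon> :: real assume "0 < \<epsilon>"
  then obtain \<delta> where "\<delta> > 0" "\<forall>s\<in>T. \<bar>s - t\<bar> < \<delta> \<longrightarrow>
       \<bar>f (fwd_jump T t) - f s - D * (fwd_jump T t - s)\<bar> \<le> \<epsilon> * \<bar>fwd_jump T t - s\<bar>"
    using assms by blast
  thus "\<exists>U. open U \<and> t \<in> U \<and>
        (\<forall>s\<in>U \<inter> T. \<bar>f (fwd_jump T t) - f s - D * (fwd_jump T t - s)\<bar> \<le> \<epsilon> * \<bar>fwd_jump T t - s\<bar>)"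
    by (intro exI[of _ "ball t \<delta>"]) (auto simp: dist_real_def abs_minus_commute)
qed

text \<open>The choice \<open>s = t\<close> is admissible for every tolerance, so no error remains.
  Across a gap this makes \<open>D\<close> the difference quotient.\<close>

lemma has_delta_derivative_scattered:
  assumes "has_delta_derivative T f D t" "t \<in> T"
  shows "f (fwd_jump T t) - f t = D * (fwd_jump T t - t)"
proof (cases "fwd_jump T t = t")
  case False
  hence pos: "fwd_jump T t - t > 0" using fwd_jump_ge[of t T] by simp
  have "\<bar>f (fwd_jump T t) - f t - D * (fwd_jump T t - t)\<bar> \<le> 0 + e" if "e > 0" for e
  proof -
    have "e / (fwd_jump T t - t) > 0" using that pos by simp
    from has_delta_derivativeE[OF assms(1) this] obtain \<delta> where "0 < \<delta>"
      "\<And>s. s \<in> T \<Longrightarrow> \<bar>s - t\<bar> < \<delta> \<Longrightarrow>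
       \<bar>f (fwd_jump T t) - f s - D * (fwd_jump T t - s)\<bar> \<le> e / (fwd_jump T t - t) * \<bar>fwd_jump T t - s\<bar>"
      by blast
    from this(2)[OF assms(2)] this(1) show ?thesis using pos by simp
  qed
  hence "\<bar>f (fwd_jump T t) - f t - D * (fwd_jump T t - t)\<bar> \<le> 0" by (rule field_le_epsilon)
  thus ?thesis by simp
qed simp

lemma has_delta_derivative_linear:
  assumes f: "has_delta_derivative T f D t" and g: "has_delta_derivative T g D' t"
  shows "has_delta_derivative T (\<lambda>t. c * f t + d * g t) (c * D + d * D') t"
proof (rule has_delta_derivativeI)
  fix \<epsilon> :: real assume \<epsilon>: "0 < \<epsilon>"
  \<comment> \<open>The summand 1 keeps \<open>k\<close> positive when both coefficients
    vanish.\<close>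
  define k where "k = \<bar>c\<bar> + \<bar>d\<bar> + 1"
  have k: "k > 0" by (simp add: k_def)
  hence e: "\<epsilon> / k > 0" using \<epsilon> by simp
  define J where "J = fwd_jump T t"
  obtain d1 where d1: "0 < d1" "\<And>s. s \<in> T \<Longrightarrow> \<bar>s - t\<bar> < d1 \<Longrightarrow>
       \<bar>f J - f s - D * (J - s)\<bar> \<le> \<epsilon> / k * \<bar>J - s\<bar>"
    using has_delta_derivativeE[OF f e] unfolding J_def by blast
  obtain d2 where d2: "0 < d2" "\<And>s. s \<in> T \<Longrightarrow> \<bar>s - t\<bar> < d2 \<Longrightarrow>
       \<bar>g J - g s - D' * (J - s)\<bar> \<le> \<epsilon> / k * \<bar>J - s\<bar>"
    using has_delta_derivativeE[OF g e] unfolding J_def by blast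
  have "\<bar>c * f J + d * g J - (c * f s + d * g s) - (c * D + d * D') * (J - s)\<bar> \<le> \<epsilon> * \<bar>J - s\<bar>"
    if s: "s \<in> T" "\<bar>s - t\<bar> < min d1 d2" for s
  proof -
    have "c * f J + d * g J - (c * f s + d * g s) - (c * D + d * D') * (J - s)
        = c * (f J - f s - D * (J - s)) + d * (g J - g s - D' * (J - s))"
      by (simp add: algebra_simps)
    also have "\<bar>\<dots>\<bar> \<le> \<bar>c\<bar> * \<bar>f J - f s - D * (J - s)\<bar> + \<bar>d\<bar> * \<bar>g J - g s - D' * (J - s)\<bar>"
      by (simp add: abs_mult[symmetric] abs_triangle_ineq)
    also have "\<dots> \<le> \<bar>c\<bar> * (\<epsilon> / k * \<bar>J - s\<bar>) + \<bar>d\<bar> * (\<epsilon> / k * \<bar>J - s\<bar>)"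
      by (intro add_mono mult_left_mono d1(2) d2(2)) (use s in auto)
    also have "\<dots> \<le> k * (\<epsilon> / k * \<bar>J - s\<bar>)"
    proof -
      have "\<epsilon> / k * \<bar>J - s\<bar> \<ge> 0" using e by (intro mult_nonneg_nonneg) auto
      moreover have "k * (\<epsilon> / k * \<bar>J - s\<bar>) = \<bar>c\<bar> * (\<epsilon> / k * \<bar>J - s\<bar>) + \<bar>d\<bar> * (\<epsilon> / k * \<bar>J - s\<bar>) + \<epsilon> / k * \<bar>J - s\<bar>"
        unfolding k_def by (simp only: distrib_right mult_1)
      ultimately show ?thesis by linarith
    qed
    also have "\<dots> = \<epsilon> * \<bar>J - s\<bar>" using k by simp
    finally show ?thesis .
  qed
  thus "\<exists>\<delta>>0. \<forall>s\<in>T. \<bar>s - t\<bar> < \<delta> \<longrightarrow>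
     \<bar>c * f (fwd_jump T t) + d * g (fwd_jump T t) - (c * f s + d * g s)
       - (c * D + d * D') * (fwd_jump T t - s)\<bar> \<le> \<epsilon> * \<bar>fwd_jump T t - s\<bar>"
    using d1(1) d2(1) unfolding J_def by (intro exI[of _ "min d1 d2"]) auto
qed

lemma has_delta_derivative_ident: "has_delta_derivative T (\<lambda>t. t) 1 t"
  by (rule has_delta_derivativeI) (auto intro: exI[of _ 1])

lemma has_delta_derivative_imp_continuous:
  assumes f: "has_delta_derivative T f D t" and t: "t \<in> T"
  shows "continuous (at t within T) f"
  unfolding continuous_within_eps_delta
proof (intro allI impI)
  fix e :: real assume e: "0 < e"
  define J where "J = fwd_jump T t"
  \<comment> \<open>Since \<open>d\<close> below is at most 1, the distance from \<open>J\<close> to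
    \<open>s\<close> is at most 1 + |J - t|, so this tolerance contributes at most e/4. The other
    contribution, \<open>D * (t - s)\<close>, is also held below e/4 by \<open>d\<close>.\<close>
  define \<epsilon> where "\<epsilon> = e / (4 * (1 + \<bar>J - t\<bar>))"
  have "1 + \<bar>J - t\<bar> > 0" by linarith
  hence \<epsilon>: "\<epsilon> > 0" using e by (simp add: \<epsilon>_def)
  have "1 + \<bar>D\<bar> > 0" by linarith
  hence eD: "e / (4 * (1 + \<bar>D\<bar>)) > 0" using e by simp
  obtain d1 where d1: "0 < d1" "\<And>s. s \<in> T \<Longrightarrow> \<bar>s - t\<bar> < d1 \<Longrightarrow>
       \<bar>f J - f s - D * (J - s)\<bar> \<le> \<epsilon> * \<bar>J - s\<bar>"
    using has_delta_derivativeE[OF f \<epsilon>] unfolding J_def by blast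
  define d where "d = min d1 (min 1 (e / (4 * (1 + \<bar>D\<bar>))))"
  have "d > 0" using eD d1(1) by (simp add: d_def)
  moreover have "\<bar>f s - f t\<bar> < e" if s: "s \<in> T" "\<bar>s - t\<bar> < d" for s
  proof -
    have 1: "\<bar>f J - f s - D * (J - s)\<bar> \<le> \<epsilon> * \<bar>J - s\<bar>" using s by (intro d1(2)) (auto simp: d_def)
    have 2: "\<bar>f J - f t - D * (J - t)\<bar> \<le> 0"
      using has_delta_derivative_scattered[OF f t] by (simp add: J_def)
    have "\<epsilon> * \<bar>J - s\<bar> \<le> \<epsilon> * (1 + \<bar>J - t\<bar>)"
      using \<epsilon> s by (intro mult_left_mono) (auto simp: d_def)
    also have "\<dots> = e / 4"
      using \<open>1 + \<bar>J - t\<bar> > 0\<close> by (simp add: \<epsilon>_def field_simps)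
    finally have 3: "\<epsilon> * \<bar>J - s\<bar> \<le> e / 4" .
    have "\<bar>D * (t - s)\<bar> \<le> (1 + \<bar>D\<bar>) * \<bar>s - t\<bar>"
      by (auto simp: abs_mult abs_minus_commute intro!: mult_right_mono)
    also have "\<dots> \<le> (1 + \<bar>D\<bar>) * (e / (4 * (1 + \<bar>D\<bar>)))"
      using s by (intro mult_left_mono) (auto simp: d_def)
    also have "\<dots> = e / 4"
      using \<open>1 + \<bar>D\<bar> > 0\<close> by (simp add: field_simps)
    finally have 4: "\<bar>D * (t - s)\<bar> \<le> e / 4" .
    have "D * (J - s) = D * (J - t) + D * (t - s)" by (simp add: algebra_simps)
    thus ?thesis using 1 2 3 4 e by linarith
  qed
  ultimately show "\<exists>d>0. \<forall>x'\<in>T. dist x' t < d \<longrightarrow> dist (f x') (f t) < e"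
    by (auto simp: dist_real_def)
qed

text \<open>Only a left-scattered maximum escapes differentiability, and it is an isolated point,
  where continuity is automatic.\<close>

lemma delta_differentiable_imp_continuous_on:
  assumes "delta_differentiable T f"
  shows "continuous_on T f"
  unfolding continuous_on_eq_continuous_within
proof
  fix t assume t: "t \<in> T"
  show "continuous (at t within T) f"
  proof (cases "t \<in> kappa T")
    case True
    thus ?thesis using assms t has_delta_derivative_imp_continuous
      unfolding delta_differentiable_def by blast
  next
    case False
    hence max: "\<forall>s\<in>T. s \<le> t" and bwd: "bwd_jump T t < t" using t by (auto simp: kappa_def)
    have "s \<le> bwd_jump T t" if "s \<in> T" "s < t" for s
      unfolding bwd_jump_def using that by (auto intro!: cSup_upper bdd_aboveI[of _ t])
    hence iso: "s = t" if "s \<in> T" "\<bar>s - t\<bar> < t - bwd_jump T t" for s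
      using that max by force
    show ?thesis unfolding continuous_within_eps_delta
    proof (intro allI impI)
      fix e :: real assume "0 < e"
      thus "\<exists>d>0. \<forall>x'\<in>T. dist x' t < d \<longrightarrow> dist (f x') (f t) < e"
        using iso bwd by (intro exI[of _ "t - bwd_jump T t"]) (auto simp: dist_real_def dest!: iso)
    qed
  qed
qed

section \<open>Mean value inequality\<close>

text \<open>The left end point is treated separately because nothing is assumed about the derivative at a
  right-dense \<open>p\<close>: there continuity pays for the first step, at the price of a summand \<open>\<epsilon>\<close>.\<close>

lemma delta_mean_value_upper:
  assumes T: "closed T" and cont: "continuous_on T f"
    and pq: "p \<in> T" "q \<in> T" "p \<le> q"
    and der: "\<And>t. t \<in> T \<Longrightarrow> p < t \<or> (t = p \<and> p < fwd_jump T p) \<Longrightarrow> t < q \<Longrightarrow>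
      \<exists>D. has_delta_derivative T f D t \<and> D \<le> M"
  shows "f q - f p \<le> M * (q - p)"
proof -
  have eps: "f q - f p \<le> (M + \<epsilon>) * (q - p) + \<epsilon>" if \<epsilon>: "\<epsilon> > 0" for \<epsilon>
  proof -
    \<comment> \<open>Induction along the time scale: \<open>S\<close> is closed, so it contains its
      supremum, and any element below \<open>q\<close> can be moved further right within
      \<open>S\<close>. Hence the supremum is \<open>q\<close>.\<close>
    define S where "S = {t \<in> T \<inter> {p..q}. f t - f p - (M + \<epsilon>) * (t - p) \<le> \<epsilon>}"
    have "S = (T \<inter> {p..q}) \<inter> (\<lambda>t. f t - f p - (M + \<epsilon>) * (t - p)) -` {..\<epsilon>}"
      by (auto simp: S_def)
    moreover have "closed \<dots>"
      by (intro continuous_closed_preimage continuous_intros continuous_on_subset[OF cont]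
           closed_Int T closed_atLeastAtMost closed_atMost) auto
    ultimately have "closed S" by simp
    moreover have "S \<noteq> {}" using pq \<epsilon> by (auto simp: S_def)
    moreover have bdd: "bdd_above S" by (auto simp: S_def intro!: bdd_aboveI[of _ q])
    ultimately have s: "Sup S \<in> S" by (intro closed_contains_Sup)
    define s where "s = Sup S"
    have ub: "r \<le> s" if "r \<in> S" for r using that bdd unfolding s_def by (rule cSup_upper)
    have sT: "s \<in> T" "p \<le> s" "s \<le> q" and sS: "f s - f p - (M + \<epsilon>) * (s - p) \<le> \<epsilon>"
      using s by (auto simp: S_def s_def)
    have "s = q"
    proof (rule ccontr)
      assume "s \<noteq> q"
      hence sq: "s < q" using sT by simp
      show False
      proof (cases "s = p \<and> fwd_jump T s = s")
        case True
        have "continuous (at s within T) f"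
          using cont sT by (simp add: continuous_on_eq_continuous_within)
        moreover have "continuous (at s within T) (\<lambda>t. f t - f p - (M + \<epsilon>) * (t - p))"
          by (intro continuous_intros calculation)
        then obtain d where d: "d > 0"
          "\<And>r. r \<in> T \<Longrightarrow> \<bar>r - s\<bar> < d \<Longrightarrow> \<bar>(f r - f p - (M + \<epsilon>) * (r - p)) - (f s - f p - (M + \<epsilon>) * (s - p))\<bar> < \<epsilon>"
          using \<epsilon> unfolding continuous_within_eps_delta dist_real_def by metis
        obtain r where r: "r \<in> T" "s < r" "r < min q (s + d)"
          using right_denseD[of T s q "min q (s + d)"] True pq sq d(1) by auto
        have "r \<in> S" using d(2)[of r] r True by (auto simp: S_def)
        thus False using ub r by fastforce
      next
        case False
        hence "p < s \<or> (s = p \<and> p < fwd_jump T p)" using sT fwd_jump_ge[of s T] by auto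
        then obtain D where D: "has_delta_derivative T f D s" "D \<le> M" using der sT sq by blast
        \<comment> \<open>A move with slope at most \<open>M + \<epsilon>\<close> leaves the
          additive slack untouched. It serves right-dense and right-scattered \<open>s\<close>
          alike.\<close>
        have step: "r \<in> S" if r: "r \<in> T" "s < r" "r \<le> q" "f r - f s \<le> (M + \<epsilon>) * (r - s)" for r
        proof -
          have "(M + \<epsilon>) * (r - p) = (M + \<epsilon>) * (r - s) + (M + \<epsilon>) * (s - p)"
            by (simp add: algebra_simps)
          thus ?thesis using r sT sS by (auto simp: S_def)
        qed
        show False
        proof (cases "fwd_jump T s = s")
          case True
          obtain d where d: "d > 0" "\<And>r. r \<in> T \<Longrightarrow> \<bar>r - s\<bar> < d \<Longrightarrow>
             \<bar>f s - f r - D * (s - r)\<bar> \<le> \<epsilon> * \<bar>s - r\<bar>"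
            using has_delta_derivativeE[OF D(1) \<epsilon>] True by metis
          obtain r where r: "r \<in> T" "s < r" "r < min q (s + d)"
            using right_denseD[of T s q "min q (s + d)"] True pq sq d(1) by auto
          have "f r - f s \<le> (D + \<epsilon>) * (r - s)"
            using d(2)[of r] r by (auto simp: algebra_simps)
          also have "\<dots> \<le> (M + \<epsilon>) * (r - s)" using D r by (intro mult_right_mono) auto
          finally have "r \<in> S" using r by (intro step) auto
          thus False using ub r by fastforce
        next
          case False
          define r where "r = fwd_jump T s"
          have r: "r \<in> T" "s < r" "r \<le> q"
            using False fwd_jump_ge[of s T] fwd_jump_mem[OF T] fwd_jump_le[of q T s] sT pq sq
            by (auto simp: r_def)
          have "f r - f s \<le> (M + \<epsilon>) * (r - s)"
            using has_delta_derivative_scattered[OF D(1) sT(1)] r D \<epsilon>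
            by (auto simp: r_def[symmetric] intro!: mult_right_mono)
          hence "r \<in> S" using r by (intro step) auto
          thus False using ub r by fastforce
        qed
      qed
    qed
    thus ?thesis using sS by simp
  qed
  show ?thesis
  proof (rule field_le_epsilon)
    fix e :: real assume e: "e > 0"
    \<comment> \<open>The total surplus \<open>\<epsilon> * (q - p) + \<epsilon>\<close> then equals
      \<open>e\<close>.\<close>
    define \<epsilon> where "\<epsilon> = e / (q - p + 1)"
    have "\<epsilon> > 0" using e pq by (auto simp: \<epsilon>_def)
    from eps[OF this] have "f q - f p \<le> M * (q - p) + \<epsilon> * (q - p + 1)" by (simp add: algebra_simps)
    also have "\<epsilon> * (q - p + 1) = e" using pq by (simp add: \<epsilon>_def)
    finally show "f q - f p \<le> M * (q - p) + e" .
  qed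
qed

lemma delta_mean_value:
  assumes T: "closed T" and cont: "continuous_on T f"
    and pq: "p \<in> T" "q \<in> T" "p \<le> q"
    and der: "\<And>t. t \<in> T \<Longrightarrow> p < t \<or> (t = p \<and> p < fwd_jump T p) \<Longrightarrow> t < q \<Longrightarrow>
      \<exists>D. has_delta_derivative T f D t \<and> \<bar>D\<bar> \<le> M"
  shows "\<bar>f q - f p\<bar> \<le> M * (q - p)"
proof -
  have "f q - f p \<le> M * (q - p)"
  proof (rule delta_mean_value_upper[OF T cont pq])
    fix t assume t: "t \<in> T" "p < t \<or> (t = p \<and> p < fwd_jump T p)" "t < q"
    thus "\<exists>D. has_delta_derivative T f D t \<and> D \<le> M" using der[OF t] by fastforce
  qed
  moreover have "- f q - - f p \<le> M * (q - p)"
  proof (rule delta_mean_value_upper[OF T _ pq])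
    show "continuous_on T (\<lambda>t. - f t)" by (intro continuous_intros cont)
    fix t assume t: "t \<in> T" "p < t \<or> (t = p \<and> p < fwd_jump T p)" "t < q"
    obtain D where D: "has_delta_derivative T f D t" "\<bar>D\<bar> \<le> M" using der[OF t] by blast
    thus "\<exists>D. has_delta_derivative T (\<lambda>t. - f t) D t \<and> D \<le> M"
      using has_delta_derivative_linear[OF D(1) D(1), of "-1" 0] by (intro exI[of _ "-D"]) auto
  qed
  ultimately show ?thesis by linarith
qed

section \<open>Uniqueness of delta integrals and delta derivatives\<close>

text \<open>The difference of two antiderivatives has delta derivative 0, so the mean value
  inequality with bound 0 makes it constant. This justifies the definite description in
  \<open>delta_integral\<close>.\<close>

lemma delta_integral_eq:
  assumes T: "closed T" and F: "delta_antiderivative T g F" and cd: "c \<in> T" "d \<in> T"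
  shows "delta_integral T c d g = F d - F c"
  unfolding delta_integral_def
proof (rule the_equality)
  show "\<exists>Fa. delta_antiderivative T g Fa \<and> F d - F c = Fa d - Fa c" using F by blast
next
  fix I assume "\<exists>Fa. delta_antiderivative T g Fa \<and> I = Fa d - Fa c"
  then obtain G where G: "delta_antiderivative T g G" and I: "I = G d - G c" by blast
  define E where "E = (\<lambda>t. 1 * F t + (- 1) * G t)"
  have der: "has_delta_derivative T E 0 t" if "t \<in> kappa T" for t
    using has_delta_derivative_linear[of T F "g t" t G "g t" 1 "-1"] F G that
    by (simp add: delta_antiderivative_def E_def)
  hence "delta_differentiable T E" unfolding delta_differentiable_def by blast
  hence cont: "continuous_on T E" by (rule delta_differentiable_imp_continuous_on)
  have "E q = E p" if pq: "p \<in> T" "q \<in> T" "p \<le> q" for p q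
  proof -
    have "\<bar>E q - E p\<bar> \<le> 0 * (q - p)"
      by (rule delta_mean_value[OF T cont pq]) (use der less_mem_kappa pq in force)
    thus ?thesis by simp
  qed
  hence "E c = E d" using cd by (metis linear)
  thus "I = F d - F c" unfolding I E_def by simp
qed

text \<open>Such points make the factor \<open>fwd_jump T t - s\<close> nonzero, so that the
  defining inequality says something about \<open>D\<close>. The point \<open>p\<close> excludes a
  one-point time scale, where every number would be a derivative.\<close>

lemma kappa_approx:
  assumes t: "t \<in> kappa T" and p: "p \<in> T" "p \<noteq> t" and d: "d > 0"
  shows "\<exists>s\<in>T. \<bar>s - t\<bar> < d \<and> s \<noteq> fwd_jump T t"
proof (cases "fwd_jump T t = t")
  case False
  thus ?thesis using t d by (intro bexI[of _ t]) (auto simp: kappa_def)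
next
  case True
  show ?thesis
  proof (cases "\<exists>v\<in>T. t < v")
    case True
    then obtain v where "v \<in> T" "t < v" by blast
    then obtain w where "w \<in> T" "t < w" "w < t + d"
      using right_denseD[OF \<open>fwd_jump T t = t\<close>, of v "t + d"] d by auto
    thus ?thesis using \<open>fwd_jump T t = t\<close> by (intro bexI[of _ w]) auto
  next
    case False
    hence max: "\<And>v. v \<in> T \<Longrightarrow> v \<le> t" by (simp add: not_less)
    hence "p < t" using p by (simp add: order_less_le)
    then obtain v where "v \<in> T" "t - d < v" "v < t"
      using left_denseD[OF t max p(1), of "t - d"] d by auto
    thus ?thesis using True by (intro bexI[of _ v]) auto
  qed
qed

text \<open>By linearity the zero function has derivative \<open>D - D'\<close>, and dividing by the
  nonzero factor from \<open>kappa_approx\<close> leaves |D - D'| below every tolerance.\<close>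

lemma has_delta_derivative_unique:
  assumes f: "has_delta_derivative T f D t" "has_delta_derivative T f D' t"
    and t: "t \<in> kappa T" and p: "p \<in> T" "p \<noteq> t"
  shows "D = D'"
proof -
  have der: "has_delta_derivative T (\<lambda>_. 0) (D - D') t"
    using has_delta_derivative_linear[OF f, of 1 "-1"] by simp
  have "\<bar>D - D'\<bar> \<le> 0 + e" if e: "e > 0" for e
  proof -
    obtain d where d: "d > 0" "\<And>s. s \<in> T \<Longrightarrow> \<bar>s - t\<bar> < d \<Longrightarrow>
       \<bar>(D - D') * (fwd_jump T t - s)\<bar> \<le> e * \<bar>fwd_jump T t - s\<bar>"
      by (rule has_delta_derivativeE[OF der e]) auto
    obtain s where "s \<in> T" "\<bar>s - t\<bar> < d" "s \<noteq> fwd_jump T t" using kappa_approx[OF t p d(1)] by blast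
    thus ?thesis using d(2)[of s] by (simp add: abs_mult)
  qed
  hence "\<bar>D - D'\<bar> \<le> 0" by (rule field_le_epsilon)
  thus ?thesis by simp
qed

lemma delta_deriv_eq:
  assumes "has_delta_derivative T f D t" "t \<in> kappa T" "p \<in> T" "p \<noteq> t"
  shows "delta_deriv T f t = D"
  unfolding delta_deriv_def using has_delta_derivative_unique[OF _ _ assms(2-4)] assms(1)
  by (intro the_equality) auto

text \<open>Division by the nonzero |J - s| treats dense and scattered points at once. It later
  bounds the derivatives of the smoothed zigzag.\<close>

lemma has_delta_derivative_lipschitz_bound:
  assumes f: "has_delta_derivative T f D t" and T: "closed T"
    and t: "t \<in> kappa T" and p: "p \<in> T" "p \<noteq> t"
    and lip: "\<And>u v. u \<in> T \<Longrightarrow> v \<in> T \<Longrightarrow> \<bar>f u - f v\<bar> \<le> K * \<bar>u - v\<bar>"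
  shows "\<bar>D\<bar> \<le> K"
proof (rule field_le_epsilon)
  fix e :: real assume e: "e > 0"
  define J where "J = fwd_jump T t"
  have tT: "t \<in> T" using t by (auto simp: kappa_def)
  obtain d where d: "d > 0" "\<And>s. s \<in> T \<Longrightarrow> \<bar>s - t\<bar> < d \<Longrightarrow>
       \<bar>f J - f s - D * (J - s)\<bar> \<le> e * \<bar>J - s\<bar>"
    using has_delta_derivativeE[OF f e] unfolding J_def by blast
  obtain s where s: "s \<in> T" "\<bar>s - t\<bar> < d" "s \<noteq> J"
    using kappa_approx[OF t p d(1)] unfolding J_def by blast
  have "J \<in> T" unfolding J_def by (rule fwd_jump_mem[OF T tT])
  hence "\<bar>D * (J - s)\<bar> \<le> K * \<bar>J - s\<bar> + e * \<bar>J - s\<bar>" using d(2)[OF s(1,2)] lip[of J s] s(1) by linarith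
  hence "\<bar>D\<bar> * \<bar>J - s\<bar> \<le> (K + e) * \<bar>J - s\<bar>" by (simp add: abs_mult distrib_right)
  thus "\<bar>D\<bar> \<le> K + e" using s(3) by simp
qed

section \<open>Delta derivatives of ordinarily differentiable functions\<close>

text \<open>Where the jump fixes \<open>t\<close>, the definition reduces to the ordinary
  derivative. Across a gap continuity suffices and the derivative is the difference
  quotient.\<close>

lemma has_real_derivative_imp_delta_differentiable:
  assumes g: "\<And>t. (g has_real_derivative g' t) (at t)"
  shows "delta_differentiable T g"
  unfolding delta_differentiable_def
proof
  fix t assume t: "t \<in> kappa T"
  define J where "J = fwd_jump T t"
  have Jge: "t \<le> J" unfolding J_def by (rule fwd_jump_ge)
  show "\<exists>D. has_delta_derivative T g D t"
  proof (cases "J = t")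
    case True
    have "has_delta_derivative T g (g' t) t"
    proof (rule has_delta_derivativeI)
      fix \<epsilon> :: real assume \<epsilon>: "0 < \<epsilon>"
      have "(g has_derivative (*) (g' t)) (at t)" using g[of t] by (simp add: has_field_derivative_def)
      then obtain d where d: "d > 0" "\<And>s. norm (s - t) < d \<Longrightarrow> norm (g s - g t - g' t * (s - t)) \<le> \<epsilon> * norm (s - t)"
        using \<epsilon> unfolding has_derivative_at_alt by blast
      have "\<bar>g t - g s - g' t * (t - s)\<bar> \<le> \<epsilon> * \<bar>t - s\<bar>" if "\<bar>s - t\<bar> < d" for s
      proof -
        have "g t - g s - g' t * (t - s) = - (g s - g t - g' t * (s - t))" by (simp add: algebra_simps)
        thus ?thesis using d(2)[of s] that by (simp add: abs_minus_commute)
      qed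
      thus "\<exists>\<delta>>0. \<forall>s\<in>T. \<bar>s - t\<bar> < \<delta> \<longrightarrow> \<bar>g (fwd_jump T t) - g s - g' t * (fwd_jump T t - s)\<bar> \<le> \<epsilon> * \<bar>fwd_jump T t - s\<bar>"
        using d(1) True unfolding J_def by auto
    qed
    thus ?thesis ..
  next
    case False
    hence J: "t < J" using Jge by simp
    define D where "D = (g J - g t) / (J - t)"
    have DJ: "D * (J - t) = g J - g t" using J by (simp add: D_def)
    have "has_delta_derivative T g D t"
    proof (rule has_delta_derivativeI)
      fix \<epsilon> :: real assume \<epsilon>: "0 < \<epsilon>"
      have "isCont (\<lambda>s. g t - g s - D * (t - s)) t"
        by (intro continuous_intros DERIV_isCont[OF g])
      moreover have "\<epsilon> * ((J - t) / 2) > 0" using \<epsilon> J by simp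
      ultimately obtain d where d: "d > 0"
        "\<And>s. \<bar>s - t\<bar> < d \<Longrightarrow> \<bar>g t - g s - D * (t - s)\<bar> < \<epsilon> * ((J - t) / 2)"
        unfolding continuous_at_eps_delta dist_real_def by (metis diff_self diff_zero mult_zero_right)
      \<comment> \<open>The second bound keeps \<open>s\<close> at distance at least (J - t)/2 from
        \<open>J\<close>, which absorbs the continuity error.\<close>
      define d' where "d' = min d ((J - t) / 2)"
      have "\<bar>g J - g s - D * (J - s)\<bar> \<le> \<epsilon> * \<bar>J - s\<bar>" if s: "\<bar>s - t\<bar> < d'" for s
      proof -
        have "g J - g s - D * (J - s) = (g t - g s - D * (t - s)) + (g J - g t - D * (J - t))"
          by (simp add: algebra_simps)
        also have "\<bar>\<dots>\<bar> \<le> \<epsilon> * ((J - t) / 2)" using d(2)[of s] s by (simp add: DJ d'_def)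
        also have "(J - t) / 2 \<le> \<bar>J - s\<bar>" using s unfolding d'_def by (simp add: abs_if min_def split: if_splits)
        hence "\<epsilon> * ((J - t) / 2) \<le> \<epsilon> * \<bar>J - s\<bar>" using \<epsilon> by (intro mult_left_mono) auto
        finally show ?thesis .
      qed
      thus "\<exists>\<delta>>0. \<forall>s\<in>T. \<bar>s - t\<bar> < \<delta> \<longrightarrow> \<bar>g (fwd_jump T t) - g s - D * (fwd_jump T t - s)\<bar> \<le> \<epsilon> * \<bar>fwd_jump T t - s\<bar>"
        using d(1) J unfolding J_def[symmetric] by (intro exI[of _ d']) (auto simp: d'_def)
    qed
    thus ?thesis ..
  qed
qed

section \<open>The ceiling of a time scale and its ordinary integrals\<close>

text \<open>Unlike \<open>fwd_jump\<close>, it fixes the points of \<open>T\<close>. The default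
  \<open>u\<close> to the right of all points keeps it monotone on the whole line.\<close>

definition ts_ceil :: "real set \<Rightarrow> real \<Rightarrow> real" where
  "ts_ceil T u = (if {v\<in>T. u \<le> v} = {} then u else Inf {v\<in>T. u \<le> v})"

lemma ts_ceil_ge: "u \<le> ts_ceil T u"
  unfolding ts_ceil_def by (auto intro!: cInf_greatest)

lemma ts_ceil_le: "v \<in> T \<Longrightarrow> u \<le> v \<Longrightarrow> ts_ceil T u \<le> v"
  unfolding ts_ceil_def by (auto intro!: cInf_lower bdd_belowI[of _ u])

lemma ts_ceil_mem:
  assumes "closed T" "v \<in> T" "u \<le> v"
  shows "ts_ceil T u \<in> T"
proof -
  have "Inf {v\<in>T. u \<le> v} \<in> closure {v\<in>T. u \<le> v}"
    by (rule closure_contains_Inf) (use assms in \<open>auto intro!: bdd_belowI[of _ u]\<close>)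
  also have "\<dots> \<subseteq> closure T" by (rule closure_mono) auto
  finally show ?thesis using assms by (auto simp add: ts_ceil_def)
qed

lemma ts_ceil_eqI: "v \<in> T \<Longrightarrow> u \<le> v \<Longrightarrow> (\<And>w. w \<in> T \<Longrightarrow> u \<le> w \<Longrightarrow> v \<le> w) \<Longrightarrow> ts_ceil T u = v"
  using cInf_eq_minimum[of v "{v\<in>T. u \<le> v}"] by (auto simp: ts_ceil_def)

text \<open>On a gap the ceiling is constant, so the ordinary integral across it is
  \<open>f (fwd_jump T t)\<close> times the length of the gap, as the delta integral
  requires.\<close>

lemma ts_ceil_scattered:
  assumes "closed T" "t \<in> T" "t < u" "u \<le> fwd_jump T t"
  shows "ts_ceil T u = fwd_jump T t"
  using assms fwd_jump_mem[OF assms(1,2)] by (intro ts_ceil_eqI) (auto intro: fwd_jump_le)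

text \<open>Monotonicity supplies Borel measurability and bounds on intervals.\<close>

lemma mono_ts_ceil: "mono (ts_ceil T)"
proof (rule monoI)
  fix u v :: real assume uv: "u \<le> v"
  show "ts_ceil T u \<le> ts_ceil T v"
  proof (cases "{w\<in>T. v \<le> w} = {}")
    case True
    hence v: "ts_ceil T v = v" by (simp add: ts_ceil_def)
    show ?thesis
    proof (cases "{w\<in>T. u \<le> w} = {}")
      case False
      then obtain w where "w \<in> T" "u \<le> w" by blast
      thus ?thesis using True v ts_ceil_le[of w T u] by force
    qed (use uv v in \<open>simp add: ts_ceil_def\<close>)
  next
    case False
    hence "ts_ceil T v = Inf {w\<in>T. v \<le> w}" by (simp only: ts_ceil_def if_False)
    also have "\<dots> \<ge> ts_ceil T u" by (rule cInf_greatest[OF False]) (use uv in \<open>auto intro: ts_ceil_le\<close>)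
    finally show ?thesis .
  qed
qed

lemma ts_ceil_interval:
  assumes "closed T" "a \<in> T" "b \<in> T" "a \<le> u" "u \<le> b"
  shows "ts_ceil ({a..b} \<inter> T) u = ts_ceil T u"
  using assms ts_ceil_mem[of T b u] ts_ceil_ge[of u T] ts_ceil_le[of b T u]
  by (intro ts_ceil_eqI) (auto intro: ts_ceil_le)

lemma integrable_ts_ceil:
  fixes f :: "real \<Rightarrow> real"
  assumes T: "closed T" and cont: "continuous_on T f" and t: "t \<in> T"
  shows "(\<lambda>u. f (ts_ceil T u)) integrable_on {s..t}"
proof -
  \<comment> \<open>\<open>f\<close> is continuous only on \<open>T\<close>; a Tietze extension
    makes the composition Borel measurable, and the ceiling takes values in \<open>T\<close> on
    \<open>{s..t}\<close>, where both agree.\<close>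
  obtain g where g: "continuous_on UNIV g" "\<And>v. v \<in> T \<Longrightarrow> g v = f v"
    using Tietze_unbounded[OF cont, of UNIV] T by auto
  have "compact (g ` {ts_ceil T s..ts_ceil T t})"
    by (intro compact_continuous_image continuous_on_subset[OF g(1)]) auto
  then obtain B where B: "\<And>v. v \<in> {ts_ceil T s..ts_ceil T t} \<Longrightarrow> \<bar>g v\<bar> \<le> B"
    using bounded_iff[of "g ` {ts_ceil T s..ts_ceil T t}"] compact_imp_bounded by (metis imageI real_norm_def)
  have "(\<lambda>u. g (ts_ceil T u)) integrable_on {s..t}"
  proof (rule measurable_bounded_by_integrable_imp_integrable_real)
    have "(\<lambda>u. g (ts_ceil T u)) \<in> borel_measurable borel"
      by (intro measurable_compose[OF borel_measurable_mono[OF mono_ts_ceil] borel_measurable_continuous_onI] g)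
    thus "(\<lambda>u. g (ts_ceil T u)) \<in> borel_measurable (lebesgue_on {s..t})"
      by (intro measurable_restrict_space1 measurable_completion) simp
    show "(\<lambda>_. B) integrable_on {s..t}" by (rule integrable_const_ivl)
    show "\<bar>g (ts_ceil T u)\<bar> \<le> B" if "u \<in> {s..t}" for u
      using that by (intro B) (auto intro!: monoD[OF mono_ts_ceil])
  qed simp
  moreover have "g (ts_ceil T u) = f (ts_ceil T u)" if "u \<in> {s..t}" for u
    using that by (intro g ts_ceil_mem[OF T t]) auto
  ultimately show ?thesis by (rule integrable_eq)
qed

text \<open>A time scale need not have a least point, so the primitive starts at an arbitrary base
  point and changes sign to its left.\<close>

lemma ex_oriented_integral:
  fixes \<phi> :: "real \<Rightarrow> real"
  assumes T: "T \<noteq> {}" and int: "\<And>s t. s \<in> T \<Longrightarrow> t \<in> T \<Longrightarrow> s \<le> t \<Longrightarrow> \<phi> integrable_on {s..t}"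
  shows "\<exists>F. \<forall>s\<in>T. \<forall>t\<in>T. s \<le> t \<longrightarrow> F t - F s = integral {s..t} \<phi>"
proof -
  obtain o' where o: "o' \<in> T" using T by blast
  define F where "F = (\<lambda>t. if o' \<le> t then integral {o'..t} \<phi> else - integral {t..o'} \<phi>)"
  have "F t - F s = integral {s..t} \<phi>" if st: "s \<in> T" "t \<in> T" "s \<le> t" for s t
  proof -
    consider "o' \<le> s" | "s < o'" "o' \<le> t" | "t < o'" using st by linarith
    thus ?thesis
    proof cases
      case 1
      thus ?thesis using Henstock_Kurzweil_Integration.integral_combine[OF 1 st(3) int[OF o st(2)]] st
        by (simp add: F_def)
    next
      case 2
      thus ?thesis using Henstock_Kurzweil_Integration.integral_combine[of s o' t, OF _ _ int[OF st]]
        by (simp add: F_def)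
    next
      case 3
      thus ?thesis using Henstock_Kurzweil_Integration.integral_combine[of s t o', OF _ _ int[OF st(1) o]] st
        by (simp add: F_def)
    qed
  qed
  thus ?thesis by blast
qed

section \<open>Delta integrals as ordinary integrals\<close>

text \<open>The primitive of the composition with the ceiling works: at a right-dense point by
  continuity of \<open>f\<close>, across a gap because the integrand is constant there.\<close>

lemma ex_delta_antiderivative:
  assumes T: "time_scale T" and cont: "continuous_on T f"
  shows "\<exists>F. delta_antiderivative T (\<lambda>t. f (fwd_jump T t)) F \<and>
    (\<forall>s\<in>T. \<forall>t\<in>T. s \<le> t \<longrightarrow> F t - F s = integral {s..t} (\<lambda>u. f (ts_ceil T u)))"
proof -
  define \<phi> where "\<phi> = (\<lambda>u. f (ts_ceil T u))"
  have cl: "closed T" and ne: "T \<noteq> {}" using T by (auto simp: time_scale_def)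
  have int: "\<phi> integrable_on {s..t}" if "t \<in> T" for s t
    unfolding \<phi>_def by (rule integrable_ts_ceil[OF cl cont that])
  obtain F where F: "\<And>s t. s \<in> T \<Longrightarrow> t \<in> T \<Longrightarrow> s \<le> t \<Longrightarrow> F t - F s = integral {s..t} \<phi>"
    using ex_oriented_integral[OF ne int] by metis
  \<comment> \<open>If \<open>f\<close> stays within \<open>e\<close> of \<open>D\<close> on the
    points of \<open>[s, t]\<close>, so does the integrand, since the ceiling does not leave this
    interval.\<close>
  have osc: "\<bar>F t - F s - D * (t - s)\<bar> \<le> e * (t - s)"
    if st: "s \<in> T" "t \<in> T" "s \<le> t" and e: "\<And>v. v \<in> T \<Longrightarrow> s \<le> v \<Longrightarrow> v \<le> t \<Longrightarrow> \<bar>f v - D\<bar> \<le> e" for s t D e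
  proof -
    have "F t - F s - D * (t - s) = integral {s..t} \<phi> - integral {s..t} (\<lambda>_. D)"
      using F[OF st] st by simp
    also have "\<dots> = integral {s..t} (\<lambda>u. \<phi> u - D)"
      by (rule Henstock_Kurzweil_Integration.integral_diff[symmetric]) (auto intro: int st)
    also have "norm \<dots> \<le> integral {s..t} (\<lambda>_. e)"
    proof (rule integral_norm_bound_integral)
      show "(\<lambda>u. \<phi> u - D) integrable_on {s..t}"
        by (intro integrable_diff int st integrable_const_ivl)
      show "norm (\<phi> u - D) \<le> e" if u: "u \<in> {s..t}" for u
        unfolding \<phi>_def real_norm_def
        using u ts_ceil_mem[OF cl st(2), of u] ts_ceil_ge[of u T] ts_ceil_le[OF st(2), of u]
        by (intro e) auto
    qed (rule integrable_const_ivl)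
    also have "\<dots> = e * (t - s)" using st by simp
    finally show ?thesis by simp
  qed
  have "has_delta_derivative T F (f (fwd_jump T t)) t" if t: "t \<in> kappa T" for t
  proof (rule has_delta_derivativeI)
    fix \<epsilon> :: real assume \<epsilon>: "0 < \<epsilon>"
    have tT: "t \<in> T" using t by (auto simp: kappa_def)
    define J where "J = fwd_jump T t"
    have J: "J \<in> T" "t \<le> J" unfolding J_def by (rule fwd_jump_mem[OF cl tT], rule fwd_jump_ge)
    have contt: "continuous (at t within T) f"
      using cont tT by (simp add: continuous_on_eq_continuous_within)
    have scatt: "F J - F t = f J * (J - t)"
    proof -
      have "F J - F t = integral {t..J} (\<lambda>_. f J)"
        unfolding F[OF tT J]
        \<comment> \<open>The point \<open>t\<close> is its own ceiling, so the integrand may differ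
          from \<open>f J\<close> there; one point does not change the integral.\<close>
        by (rule integral_spike[of "{t}"])
           (use ts_ceil_scattered[OF cl tT] in \<open>auto simp: J_def \<phi>_def less_le\<close>)
      thus ?thesis using J by simp
    qed
    show "\<exists>\<delta>>0. \<forall>s\<in>T. \<bar>s - t\<bar> < \<delta> \<longrightarrow>
        \<bar>F (fwd_jump T t) - F s - f (fwd_jump T t) * (fwd_jump T t - s)\<bar> \<le> \<epsilon> * \<bar>fwd_jump T t - s\<bar>"
    proof (cases "J = t")
      case True
      obtain d where d: "d > 0" "\<And>s. s \<in> T \<Longrightarrow> \<bar>s - t\<bar> < d \<Longrightarrow> \<bar>f s - f t\<bar> < \<epsilon>"
        using contt \<epsilon> unfolding continuous_within_eps_delta dist_real_def by metis
      have "\<bar>F t - F s - f t * (t - s)\<bar> \<le> \<epsilon> * \<bar>t - s\<bar>" if s: "s \<in> T" "\<bar>s - t\<bar> < d" for s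
      proof (cases "s \<le> t")
        case True
        have "\<bar>f v - f t\<bar> \<le> \<epsilon>" if "v \<in> T" "s \<le> v" "v \<le> t" for v
          using d(2)[of v] that s by simp
        from osc[OF s(1) tT True this] show ?thesis using True by simp
      next
        case False
        have "\<bar>f v - f t\<bar> \<le> \<epsilon>" if "v \<in> T" "t \<le> v" "v \<le> s" for v
          using d(2)[of v] that s by simp
        from osc[OF tT s(1) _ this] show ?thesis using False by (simp add: algebra_simps abs_le_iff)
      qed
      thus ?thesis using d(1) True unfolding J_def by auto
    next
      case False
      hence Jt: "t < J" using J by simp
      obtain d where d: "d > 0" "\<And>s. s \<in> T \<Longrightarrow> \<bar>s - t\<bar> < d \<Longrightarrow> \<bar>f s - f t\<bar> < 1"
        using contt unfolding continuous_within_eps_delta dist_real_def by (metis zero_less_one)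
      define B where "B = 1 + \<bar>f t - f J\<bar>"
      have B: "B > 0" by (simp add: B_def add_pos_nonneg)
      \<comment> \<open>The three bounds give |f s - f t| < 1, exclude points to the right of
        \<open>t\<close> since the next one is \<open>J\<close>, and bring the error
        \<open>B * (t - s)\<close> below \<open>\<epsilon> * (J - t)\<close>.\<close>
      define d' where "d' = min d (min (J - t) (\<epsilon> * (J - t) / B))"
      have d': "d' > 0" using d(1) Jt \<epsilon> B by (simp add: d'_def)
      have "\<bar>F J - F s - f J * (J - s)\<bar> \<le> \<epsilon> * \<bar>J - s\<bar>" if s: "s \<in> T" "\<bar>s - t\<bar> < d'" for s
      proof -
        have "\<not> t < s" using fwd_jump_le[of s T t] s by (auto simp: J_def[symmetric] d'_def)
        hence st: "s \<le> t" by simp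
        have "\<bar>f v - f J\<bar> \<le> B" if "v \<in> T" "s \<le> v" "v \<le> t" for v
          using d(2)[of v] that s by (auto simp: d'_def B_def)
        from osc[OF s(1) tT st this] have 1: "\<bar>F t - F s - f J * (t - s)\<bar> \<le> B * (t - s)" .
        have "F J - F s - f J * (J - s) = F t - F s - f J * (t - s)"
          using scatt by (simp add: algebra_simps)
        hence "\<bar>F J - F s - f J * (J - s)\<bar> \<le> B * (t - s)" using 1 by simp
        also have "\<dots> \<le> B * (\<epsilon> * (J - t) / B)" using B s by (intro mult_left_mono) (auto simp: d'_def)
        also have "\<dots> \<le> \<epsilon> * \<bar>J - s\<bar>" using B \<epsilon> st Jt by simp
        finally show ?thesis .
      qed
      thus ?thesis using d' unfolding J_def by blast
    qed
  qed
  thus ?thesis using F unfolding delta_antiderivative_def \<phi>_def by blast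
qed

lemma delta_integral_fwd_jump:
  assumes T: "time_scale T" and cont: "continuous_on T f" and cd: "c \<in> T" "d \<in> T" "c \<le> d"
  shows "delta_integral T c d (\<lambda>t. f (fwd_jump T t)) = integral {c..d} (\<lambda>u. f (ts_ceil T u))"
proof -
  obtain F where F: "delta_antiderivative T (\<lambda>t. f (fwd_jump T t)) F"
    "\<forall>s\<in>T. \<forall>t\<in>T. s \<le> t \<longrightarrow> F t - F s = integral {s..t} (\<lambda>u. f (ts_ceil T u))"
    using ex_delta_antiderivative[OF T cont] by blast
  have "closed T" using T by (simp add: time_scale_def)
  from delta_integral_eq[OF this F(1) cd(1,2)] show ?thesis using F(2) cd by simp
qed

section \<open>The function h_2 as an ordinary integral\<close>

text \<open>The error factors exactly as (s - t)(\<sigma>(t) - s), so the tolerance itself serves as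
  radius.\<close>

lemma has_delta_derivative_square:
  assumes "closed T" "t \<in> T"
  shows "has_delta_derivative T (\<lambda>t. t * t) (t + fwd_jump T t) t"
proof (rule has_delta_derivativeI)
  fix \<epsilon> :: real assume \<epsilon>: "0 < \<epsilon>"
  have "\<bar>fwd_jump T t * fwd_jump T t - s * s - (t + fwd_jump T t) * (fwd_jump T t - s)\<bar> \<le> \<epsilon> * \<bar>fwd_jump T t - s\<bar>"
    if "\<bar>s - t\<bar> < \<epsilon>" for s
  proof -
    have "fwd_jump T t * fwd_jump T t - s * s - (t + fwd_jump T t) * (fwd_jump T t - s) = (s - t) * (fwd_jump T t - s)"
      by (simp add: algebra_simps)
    also have "\<bar>\<dots>\<bar> \<le> \<epsilon> * \<bar>fwd_jump T t - s\<bar>"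
      unfolding abs_mult using that by (intro mult_right_mono) auto
    finally show ?thesis .
  qed
  thus "\<exists>\<delta>>0. \<forall>s\<in>T. \<bar>s - t\<bar> < \<delta> \<longrightarrow>
     \<bar>fwd_jump T t * fwd_jump T t - s * s - (t + fwd_jump T t) * (fwd_jump T t - s)\<bar> \<le> \<epsilon> * \<bar>fwd_jump T t - s\<bar>"
    using \<epsilon> by blast
qed

lemma ts_h_1:
  assumes "closed T" "t \<in> T" "s \<in> T"
  shows "ts_h T (Suc 0) t s = t - s"
proof -
  have "delta_antiderivative T (\<lambda>_. 1) (\<lambda>t. t)"
    unfolding delta_antiderivative_def using has_delta_derivative_ident by blast
  from delta_integral_eq[OF assms(1) this assms(3,2)] show ?thesis by simp
qed

text \<open>Since \<open>(t\<^sup>2)\<^sup>\<Delta> = t + \<sigma>(t)\<close>, an antiderivative of the identity is obtained from one of \<open>\<sigma>\<close>.\<close>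

lemma ts_h_2:
  assumes T: "time_scale T" and st: "s \<in> T" "t \<in> T"
  shows "ts_h T 2 t s = integral {min s t..max s t} (\<lambda>u. \<bar>ts_ceil T u - t\<bar>)"
proof -
  have cl: "closed T" using T by (auto simp: time_scale_def)
  obtain C where C: "delta_antiderivative T (fwd_jump T) C"
    "\<And>s t. s \<in> T \<Longrightarrow> t \<in> T \<Longrightarrow> s \<le> t \<Longrightarrow> C t - C s = integral {s..t} (ts_ceil T)"
    using ex_delta_antiderivative[OF T, of "\<lambda>t. t"] by (auto simp: continuous_on_id)
  \<comment> \<open>The first two terms have derivative (\<tau> + \<sigma>(\<tau>)) -
    \<sigma>(\<tau>) = \<tau>, and the last one subtracts \<open>s\<close>. The explicit
    coefficients fit \<open>has_delta_derivative_linear\<close>.\<close>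
  define F where "F = (\<lambda>\<tau>. 1 * (1 * (\<tau> * \<tau>) + (- 1) * C \<tau>) + (- s) * \<tau>)"
  have "has_delta_derivative T F (ts_h T (Suc 0) \<tau> s) \<tau>" if "\<tau> \<in> kappa T" for \<tau>
  proof -
    have \<tau>: "\<tau> \<in> T" using that by (auto simp: kappa_def)
    have "has_delta_derivative T F (1 * (1 * (\<tau> + fwd_jump T \<tau>) + (-1) * fwd_jump T \<tau>) + (- s) * 1) \<tau>"
      unfolding F_def using that C(1)
      by (intro has_delta_derivative_linear has_delta_derivative_square has_delta_derivative_ident cl \<tau>)
         (auto simp: delta_antiderivative_def)
    thus ?thesis using ts_h_1[OF cl \<tau> st(1)] by simp
  qed
  hence "delta_antiderivative T (\<lambda>\<tau>. ts_h T (Suc 0) \<tau> s) F"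
    unfolding delta_antiderivative_def by blast
  from delta_integral_eq[OF cl this st] have h: "ts_h T 2 t s = F t - F s"
    by (simp add: numeral_2_eq_2)
  have int: "(\<lambda>u. ts_ceil T u) integrable_on {p..q}" if "q \<in> T" for p q
    using integrable_ts_ceil[OF cl continuous_on_id that] .
  show ?thesis
  proof (cases "s \<le> t")
    case True
    have "integral {s..t} (\<lambda>u. \<bar>ts_ceil T u - t\<bar>) = integral {s..t} (\<lambda>u. t - ts_ceil T u)"
    proof (rule Henstock_Kurzweil_Integration.integral_cong)
      show "\<bar>ts_ceil T u - t\<bar> = t - ts_ceil T u" if "u \<in> {s..t}" for u
        using that ts_ceil_le[OF st(2), of u] by simp
    qed
    also have "\<dots> = integral {s..t} (\<lambda>u. t) - integral {s..t} (ts_ceil T)"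
      by (intro Henstock_Kurzweil_Integration.integral_diff int st integrable_const_ivl)
    also have "\<dots> = F t - F s" using C(2)[OF st True] True by (simp add: F_def algebra_simps)
    finally show ?thesis using True h by simp
  next
    case False
    \<comment> \<open>Here the ceiling lies above \<open>t\<close>; the sign of the integrand and
      the orientation of the integral both change, so the absolute value serves both orders.\<close>
    have "integral {t..s} (\<lambda>u. \<bar>ts_ceil T u - t\<bar>) = integral {t..s} (\<lambda>u. ts_ceil T u - t)"
    proof (rule Henstock_Kurzweil_Integration.integral_cong)
      show "\<bar>ts_ceil T u - t\<bar> = ts_ceil T u - t" if "u \<in> {t..s}" for u
        using that ts_ceil_ge[of u T] by simp
    qed
    also have "\<dots> = integral {t..s} (ts_ceil T) - integral {t..s} (\<lambda>u. t)"
      by (intro Henstock_Kurzweil_Integration.integral_diff int st integrable_const_ivl)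
    also have "\<dots> = F t - F s" using C(2)[OF st(2,1)] False by (simp add: F_def algebra_simps)
    finally show ?thesis using False h by simp
  qed
qed

text \<open>Points beyond \<open>b\<close> do not lower the infimum because \<open>b\<close> itself
  is a candidate. At \<open>t = b\<close> the two jumps may differ.\<close>

lemma fwd_jump_interval:
  assumes "a \<in> T" "b \<in> T" "a \<le> t" "t < b"
  shows "fwd_jump ({a..b} \<inter> T) t = fwd_jump T t"
proof (rule antisym)
  have "fwd_jump ({a..b} \<inter> T) t \<le> s" if s: "s \<in> T" "t < s" for s
  proof (cases "s \<le> b")
    case True
    thus ?thesis using s assms by (intro fwd_jump_le) auto
  next
    case False
    have "fwd_jump ({a..b} \<inter> T) t \<le> b" using assms by (intro fwd_jump_le) auto
    thus ?thesis using False by simp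
  qed
  hence "fwd_jump ({a..b} \<inter> T) t \<le> Inf {s\<in>T. t < s}"
    using assms by (intro cInf_greatest) auto
  thus "fwd_jump ({a..b} \<inter> T) t \<le> fwd_jump T t" using assms by (auto simp: fwd_jump_def)
  have "fwd_jump T t \<le> Inf {s\<in>{a..b} \<inter> T. t < s}"
    using assms by (intro cInf_greatest) (auto intro!: fwd_jump_le exI[of _ b])
  thus "fwd_jump T t \<le> fwd_jump ({a..b} \<inter> T) t" using assms by (auto simp: fwd_jump_def)
qed

section \<open>Smoothing of the absolute value\<close>

text \<open>This is the derivative of the convex function sqrt(r^2 + \<eta>^2). Nonnegative
  arguments are compared by squaring; odd symmetry gives the rest.\<close>

lemma mono_smooth_abs_deriv:
  fixes r q \<eta> :: real
  assumes "\<eta> > 0" "r \<le> q"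
  shows "r / sqrt (r\<^sup>2 + \<eta>\<^sup>2) \<le> q / sqrt (q\<^sup>2 + \<eta>\<^sup>2)"
proof -
  have pos: "sqrt (u\<^sup>2 + \<eta>\<^sup>2) > 0" for u using assms(1) by (simp add: add_nonneg_pos)
  have nonneg: "u / sqrt (u\<^sup>2 + \<eta>\<^sup>2) \<le> v / sqrt (v\<^sup>2 + \<eta>\<^sup>2)" if uv: "0 \<le> u" "u \<le> v" for u v :: real
  proof -
    have "(u * sqrt (v\<^sup>2 + \<eta>\<^sup>2))\<^sup>2 \<le> (v * sqrt (u\<^sup>2 + \<eta>\<^sup>2))\<^sup>2"
      using uv by (simp add: power_mult_distrib algebra_simps mult_left_mono power_mono)
    hence "u * sqrt (v\<^sup>2 + \<eta>\<^sup>2) \<le> v * sqrt (u\<^sup>2 + \<eta>\<^sup>2)"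
      by (rule power2_le_imp_le) (use uv in simp)
    thus ?thesis using pos by (simp add: divide_simps mult.commute)
  qed
  consider "0 \<le> r" | "r \<le> 0" "0 \<le> q" | "q \<le> 0" by linarith
  thus ?thesis
  proof cases
    case 2
    hence "r / sqrt (r\<^sup>2 + \<eta>\<^sup>2) \<le> 0" "0 \<le> q / sqrt (q\<^sup>2 + \<eta>\<^sup>2)"
      by (auto simp: divide_nonpos_nonneg)
    thus ?thesis by linarith
  next
    case 3
    thus ?thesis using nonneg[of "-q" "-r"] assms by simp
  qed (use nonneg assms in auto)
qed

lemma smooth_abs_deriv_le_1: "\<bar>r / sqrt (r\<^sup>2 + \<eta>\<^sup>2)\<bar> \<le> (1::real)"
proof -
  define S where "S = sqrt (r\<^sup>2 + \<eta>\<^sup>2)"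
  have "\<bar>r\<bar> \<le> S" unfolding S_def by (intro real_le_rsqrt) simp
  hence "\<bar>r / S\<bar> \<le> 1" by (cases "S = 0") (auto simp: abs_divide divide_le_eq_1)
  thus ?thesis unfolding S_def .
qed

lemma smooth_abs_approx:
  assumes "(\<eta>::real) > 0"
  shows "\<bar>sqrt (r\<^sup>2 + \<eta>\<^sup>2) - \<bar>r\<bar>\<bar> \<le> \<eta>"
proof -
  have "sqrt (r\<^sup>2 + \<eta>\<^sup>2) \<le> \<bar>r\<bar> + \<eta>"
    using sqrt_add_le_add_sqrt[of "r\<^sup>2" "\<eta>\<^sup>2"] assms by simp
  moreover have "\<bar>r\<bar> \<le> sqrt (r\<^sup>2 + \<eta>\<^sup>2)" by (intro real_le_rsqrt) simp
  ultimately show ?thesis by linarith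
qed

section \<open>Quadrature errors with a single node\<close>

text \<open>The error of replacing the function by its value at the node \<open>p\<close> on the
  piece \<open>[s, t]\<close>.\<close>

definition osc_integral :: "real set \<Rightarrow> real \<Rightarrow> real \<Rightarrow> real \<Rightarrow> (real \<Rightarrow> real) \<Rightarrow> real" where
  "osc_integral T s t p f = integral {s..t} (\<lambda>u. f (ts_ceil T u) - f p)"

lemma osc_integral_eq:
  assumes "closed T" "continuous_on T f" "t \<in> T" "s \<le> t"
  shows "osc_integral T s t p f = integral {s..t} (\<lambda>u. f (ts_ceil T u)) - (t - s) * f p"
  unfolding osc_integral_def
  using Henstock_Kurzweil_Integration.integral_diff[OF integrable_ts_ceil[OF assms(1-3), of s] integrable_const_ivl[of "f p"]] assms(4)
  by simp

lemma osc_integral_linear: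
  assumes "closed T" "continuous_on T f" "continuous_on T g" "t \<in> T" "s \<le> t"
  shows "osc_integral T s t p (\<lambda>u. c * f u + d * g u) = c * osc_integral T s t p f + d * osc_integral T s t p g"
proof -
  have "((\<lambda>u. c * f (ts_ceil T u) + d * g (ts_ceil T u)) has_integral
      c * integral {s..t} (\<lambda>u. f (ts_ceil T u)) + d * integral {s..t} (\<lambda>u. g (ts_ceil T u))) {s..t}"
    using assms
    by (intro has_integral_add has_integral_mult_right integrable_integral integrable_ts_ceil)
  hence "integral {s..t} (\<lambda>u. c * f (ts_ceil T u) + d * g (ts_ceil T u)) =
      c * integral {s..t} (\<lambda>u. f (ts_ceil T u)) + d * integral {s..t} (\<lambda>u. g (ts_ceil T u))"
    by (rule integral_unique)
  moreover have "continuous_on T (\<lambda>u. c * f u + d * g u)" by (intro continuous_intros assms)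
  ultimately show ?thesis using assms by (simp add: osc_integral_eq algebra_simps)
qed

text \<open>The integrand is bounded pointwise. Through \<open>err_bound\<close> the two-term
  estimate covers Lipschitz functions (\<open>\<delta> = 0\<close>), uniformly small ones
  (\<open>K = 0\<close>) and uniformly continuous ones.\<close>

lemma osc_integral_bound:
  assumes T: "closed T" and cont: "continuous_on T f" and st: "t \<in> T" "s \<le> t"
    and bound: "\<And>v. v \<in> T \<Longrightarrow> \<bar>f v - f p\<bar> \<le> \<delta> + K * \<bar>v - p\<bar>"
  shows "\<bar>osc_integral T s t p f\<bar> \<le> \<delta> * (t - s) + K * integral {s..t} (\<lambda>u. \<bar>ts_ceil T u - p\<bar>)"
proof -
  have int: "(\<lambda>u. \<bar>ts_ceil T u - p\<bar>) integrable_on {s..t}"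
    by (rule integrable_ts_ceil[OF T _ st(1)]) (intro continuous_intros)
  have "norm (osc_integral T s t p f) \<le> integral {s..t} (\<lambda>u. \<delta> + K * \<bar>ts_ceil T u - p\<bar>)"
    unfolding osc_integral_def
  proof (rule integral_norm_bound_integral)
    show "(\<lambda>u. f (ts_ceil T u) - f p) integrable_on {s..t}"
      by (intro integrable_diff integrable_ts_ceil[OF T cont st(1)] integrable_const_ivl)
    show "(\<lambda>u. \<delta> + K * \<bar>ts_ceil T u - p\<bar>) integrable_on {s..t}"
      by (intro integrable_add integrable_const_ivl integrable_on_cmult_left[where 'b=real, simplified] int)
    show "norm (f (ts_ceil T u) - f p) \<le> \<delta> + K * \<bar>ts_ceil T u - p\<bar>" if "u \<in> {s..t}" for u
      using bound[OF ts_ceil_mem[OF T st(1), of u]] that by simp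
  qed
  also have "((\<lambda>u. \<delta> + K * \<bar>ts_ceil T u - p\<bar>) has_integral (\<delta> * (t - s) + K * integral {s..t} (\<lambda>u. \<bar>ts_ceil T u - p\<bar>))) {s..t}"
    using has_integral_const_real[of \<delta> s t] st
    by (intro has_integral_add has_integral_mult_right integrable_integral int) (simp add: mult.commute)
  hence "integral {s..t} (\<lambda>u. \<delta> + K * \<bar>ts_ceil T u - p\<bar>) = \<delta> * (t - s) + K * integral {s..t} (\<lambda>u. \<bar>ts_ceil T u - p\<bar>)"
    by (rule integral_unique)
  finally show ?thesis by simp
qed

text \<open>The equality case of \<open>osc_integral_bound\<close> for \<open>\<delta> = 0\<close>
  and \<open>K = 1\<close>.\<close>

lemma osc_integral_eq_abs:
  assumes T: "closed T" and st: "s \<in> T" "t \<in> T"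
    and eq: "\<And>v. v \<in> T \<Longrightarrow> s \<le> v \<Longrightarrow> v \<le> t \<Longrightarrow> f v - f p = \<bar>v - p\<bar>"
  shows "osc_integral T s t p f = integral {s..t} (\<lambda>u. \<bar>ts_ceil T u - p\<bar>)"
  unfolding osc_integral_def
proof (rule Henstock_Kurzweil_Integration.integral_cong)
  fix u assume "u \<in> {s..t}"
  thus "f (ts_ceil T u) - f p = \<bar>ts_ceil T u - p\<bar>"
    using ts_ceil_mem[OF T st(2), of u] ts_ceil_ge[of u T] ts_ceil_le[OF st(2), of u] by (intro eq) auto
qed

text \<open>\<open>ts_h\<close> is formed on all of \<open>T\<close>, the quadrature error on
  \<open>[a, b]\<close> only; the two ceilings agree there.\<close>

lemma ts_h_2_interval:
  assumes T: "time_scale T" and ab: "a \<in> T" "b \<in> T" and st: "s \<in> {a..b} \<inter> T" "t \<in> {a..b} \<inter> T"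
  shows "ts_h T 2 t s = integral {min s t..max s t} (\<lambda>u. \<bar>ts_ceil ({a..b} \<inter> T) u - t\<bar>)"
proof -
  have "closed T" using T by (simp add: time_scale_def)
  hence "integral {min s t..max s t} (\<lambda>u. \<bar>ts_ceil ({a..b} \<inter> T) u - t\<bar>)
      = integral {min s t..max s t} (\<lambda>u. \<bar>ts_ceil T u - t\<bar>)"
    by (intro Henstock_Kurzweil_Integration.integral_cong) (use ab st in \<open>auto simp: ts_ceil_interval\<close>)
  thus ?thesis using ts_h_2[OF T] st by simp
qed

section \<open>The quadrature rule with four pieces\<close>

locale quadrature =
  fixes T :: "real set" and a b x \<alpha> \<beta> :: real
  assumes T: "time_scale T" and ab: "a \<in> T" "b \<in> T" "a < b"
    and x: "x \<in> {a..b} \<inter> T" and \<alpha>: "\<alpha> \<in> {a..x} \<inter> T" and \<beta>: "\<beta> \<in> {x..b} \<inter> T"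
begin

definition J :: "real set" where "J = {a..b} \<inter> T"

definition err :: "(real \<Rightarrow> real) \<Rightarrow> real" where
  "err f = osc_integral J a \<alpha> a f + osc_integral J \<alpha> x x f
         + osc_integral J x \<beta> x f + osc_integral J \<beta> b b f"

definition H :: real where
  "H = ts_h T 2 a \<alpha> + ts_h T 2 x \<alpha> + ts_h T 2 x \<beta> + ts_h T 2 b \<beta>"

text \<open>The slopes on the four pieces are 1, -1, 1, -1, so on each piece the value exceeds the
  one at the node by exactly the distance to the node. All four errors are extremal and have the
  same sign.\<close>

definition zigzag :: "real \<Rightarrow> real" where
  "zigzag t = \<bar>t - x\<bar> - \<bar>t - \<alpha>\<bar> - \<bar>t - \<beta>\<bar>"

lemma time_scale_J: "time_scale J"
proof -
  have "a \<in> {a..b} \<inter> T" using ab by simp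
  moreover have "closed ({a..b} \<inter> T)" using T by (simp add: time_scale_def closed_Int)
  ultimately show ?thesis unfolding time_scale_def J_def by blast
qed

lemma closed_J: "closed J"
  using time_scale_J by (simp add: time_scale_def)

lemma mem_J: "a \<in> J" "b \<in> J" "x \<in> J" "\<alpha> \<in> J" "\<beta> \<in> J"
  using ab x \<alpha> \<beta> by (auto simp: J_def)

lemma J_bounds: "v \<in> J \<Longrightarrow> a \<le> v" "v \<in> J \<Longrightarrow> v \<le> b"
  by (auto simp: J_def)

lemma ordered: "a \<le> \<alpha>" "\<alpha> \<le> x" "x \<le> \<beta>" "\<beta> \<le> b"
  using x \<alpha> \<beta> by auto

lemma J_other: "\<exists>p\<in>J. p \<noteq> t"
  using mem_J(1,2) ab(3) by (metis less_irrefl)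

text \<open>The four integrals recombine to one over \<open>[a, b]\<close>, and the two inner pieces
  share the node \<open>x\<close>, whence its weight \<open>\<beta> - \<alpha>\<close>.\<close>

lemma err_eq:
  assumes "continuous_on J f"
  shows "err f = delta_integral J a b (\<lambda>t. f (fwd_jump J t))
    - ((\<alpha> - a) * f a + (\<beta> - \<alpha>) * f x + (b - \<beta>) * f b)"
proof -
  define \<phi> where "\<phi> = (\<lambda>u. f (ts_ceil J u))"
  have int: "\<phi> integrable_on {s..t}" if "t \<in> J" for s t
    unfolding \<phi>_def by (rule integrable_ts_ceil[OF closed_J assms that])
  have comb: "integral {s..r} \<phi> + integral {r..t} \<phi> = integral {s..t} \<phi>" if "s \<le> r" "r \<le> t" "t \<in> J" for s r t
    using that int by (intro Henstock_Kurzweil_Integration.integral_combine)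
  have "delta_integral J a b (\<lambda>t. f (fwd_jump J t)) = integral {a..b} \<phi>"
    unfolding \<phi>_def using mem_J ab by (intro delta_integral_fwd_jump time_scale_J assms) auto
  moreover have "err f = integral {a..\<alpha>} \<phi> - (\<alpha> - a) * f a + (integral {\<alpha>..x} \<phi> - (x - \<alpha>) * f x)
      + (integral {x..\<beta>} \<phi> - (\<beta> - x) * f x) + (integral {\<beta>..b} \<phi> - (b - \<beta>) * f b)"
    unfolding err_def \<phi>_def using mem_J ordered by (simp add: osc_integral_eq[OF closed_J assms])
  ultimately show ?thesis
    using comb[of a \<alpha> x] comb[of a x \<beta>] comb[of a \<beta> b] ordered mem_J by (simp add: algebra_simps)
qed

lemma err_linear:
  assumes "continuous_on J f" "continuous_on J g"
  shows "err (\<lambda>u. c * f u + d * g u) = c * err f + d * err g"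
  unfolding err_def using mem_J ordered
  by (simp add: osc_integral_linear[OF closed_J assms] algebra_simps)

lemma H_eq:
  "H = integral {a..\<alpha>} (\<lambda>u. \<bar>ts_ceil J u - a\<bar>) + integral {\<alpha>..x} (\<lambda>u. \<bar>ts_ceil J u - x\<bar>)
     + integral {x..\<beta>} (\<lambda>u. \<bar>ts_ceil J u - x\<bar>) + integral {\<beta>..b} (\<lambda>u. \<bar>ts_ceil J u - b\<bar>)"
proof -
  have h: "ts_h T 2 t s = integral {min s t..max s t} (\<lambda>u. \<bar>ts_ceil J u - t\<bar>)" if "s \<in> J" "t \<in> J" for s t
    using ts_h_2_interval[OF T ab(1,2)] that unfolding J_def by blast
  show ?thesis
    unfolding H_def h[OF mem_J(4,1)] h[OF mem_J(4,3)] h[OF mem_J(5,3)] h[OF mem_J(5,2)]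
    using ordered by (simp add: min_absorb1 min_absorb2 max_absorb1 max_absorb2)
qed

lemma H_nonneg: "0 \<le> H"
  unfolding H_eq by (intro add_nonneg_nonneg integral_nonneg integrable_ts_ceil[OF closed_J, where f = "\<lambda>v. \<bar>v - _\<bar>"] mem_J)
    (auto intro!: continuous_intros)

lemma err_zigzag: "err zigzag = H"
proof -
  have "osc_integral J a \<alpha> a zigzag = integral {a..\<alpha>} (\<lambda>u. \<bar>ts_ceil J u - a\<bar>)"
    using ordered by (intro osc_integral_eq_abs closed_J mem_J) (auto simp: zigzag_def abs_if)
  moreover have "osc_integral J \<alpha> x x zigzag = integral {\<alpha>..x} (\<lambda>u. \<bar>ts_ceil J u - x\<bar>)"
    using ordered by (intro osc_integral_eq_abs closed_J mem_J) (auto simp: zigzag_def abs_if)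
  moreover have "osc_integral J x \<beta> x zigzag = integral {x..\<beta>} (\<lambda>u. \<bar>ts_ceil J u - x\<bar>)"
    using ordered by (intro osc_integral_eq_abs closed_J mem_J) (auto simp: zigzag_def abs_if)
  moreover have "osc_integral J \<beta> b b zigzag = integral {\<beta>..b} (\<lambda>u. \<bar>ts_ceil J u - b\<bar>)"
    using ordered by (intro osc_integral_eq_abs closed_J mem_J) (auto simp: zigzag_def abs_if)
  ultimately show ?thesis unfolding err_def H_eq by simp
qed

lemma err_bound:
  assumes cont: "continuous_on J f"
    and bound: "\<And>p q. p \<in> J \<Longrightarrow> q \<in> J \<Longrightarrow> \<bar>f q - f p\<bar> \<le> \<delta> + K * \<bar>q - p\<bar>"
  shows "\<bar>err f\<bar> \<le> \<delta> * (b - a) + K * H"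
proof -
  have piece: "\<bar>osc_integral J s t p f\<bar> \<le> \<delta> * (t - s) + K * integral {s..t} (\<lambda>u. \<bar>ts_ceil J u - p\<bar>)"
    if "t \<in> J" "s \<le> t" "p \<in> J" for s t p
    using that by (intro osc_integral_bound closed_J cont bound)
  have "\<bar>err f\<bar> \<le> \<bar>osc_integral J a \<alpha> a f\<bar> + \<bar>osc_integral J \<alpha> x x f\<bar>
         + \<bar>osc_integral J x \<beta> x f\<bar> + \<bar>osc_integral J \<beta> b b f\<bar>"
    unfolding err_def by linarith
  also have "\<dots> \<le> (\<delta> * (\<alpha> - a) + K * integral {a..\<alpha>} (\<lambda>u. \<bar>ts_ceil J u - a\<bar>))
      + (\<delta> * (x - \<alpha>) + K * integral {\<alpha>..x} (\<lambda>u. \<bar>ts_ceil J u - x\<bar>))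
      + (\<delta> * (\<beta> - x) + K * integral {x..\<beta>} (\<lambda>u. \<bar>ts_ceil J u - x\<bar>))
      + (\<delta> * (b - \<beta>) + K * integral {\<beta>..b} (\<lambda>u. \<bar>ts_ceil J u - b\<bar>))"
    by (intro add_mono piece mem_J ordered)
  also have "\<dots> = \<delta> * (b - a) + K * H" unfolding H_eq by (simp add: algebra_simps)
  finally show ?thesis .
qed

section \<open>The supremum of the delta derivative and the inequality\<close>

definition interior_pts :: "real set" where
  "interior_pts = {t\<in>T. (a < t \<or> (t = a \<and> a < fwd_jump T a)) \<and> t < b}"

lemma delta_deriv_sup_eq: "delta_deriv_sup T a b f = (SUP t\<in>interior_pts. ereal \<bar>delta_deriv J f t\<bar>)"
  unfolding delta_deriv_sup_def interior_pts_def J_def ..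

lemma interior_pts_kappa: "t \<in> interior_pts \<Longrightarrow> t \<in> kappa J"
  using ab by (intro less_mem_kappa[of t J b]) (auto simp: interior_pts_def J_def)

text \<open>Either \<open>a\<close> is right-scattered and belongs to the set, or it is right-dense
  and has points of \<open>T\<close> between itself and \<open>b\<close>. Over an empty set the
  supremum in \<open>ereal\<close> would be minus infinity.\<close>

lemma interior_pts_nonempty: "interior_pts \<noteq> {}"
proof (cases "fwd_jump T a = a")
  case True
  from right_denseD[OF this ab(2,3,3)] show ?thesis by (auto simp: interior_pts_def)
next
  case False
  thus ?thesis using fwd_jump_ge[of a T] ab by (auto simp: interior_pts_def)
qed

lemma delta_deriv_sup_nonneg: "0 \<le> delta_deriv_sup T a b f"
proof -
  obtain t where "t \<in> interior_pts" using interior_pts_nonempty by blast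
  hence "ereal \<bar>delta_deriv J f t\<bar> \<le> delta_deriv_sup T a b f"
    unfolding delta_deriv_sup_eq by (rule SUP_upper)
  moreover have "0 \<le> ereal \<bar>delta_deriv J f t\<bar>" by simp
  ultimately show ?thesis by (rule order_trans[rotated])
qed

lemma delta_deriv_J:
  assumes "has_delta_derivative J f D t" "t \<in> kappa J"
  shows "delta_deriv J f t = D"
  using J_other[of t] delta_deriv_eq[OF assms] by blast

lemma has_delta_deriv_interior:
  assumes "delta_differentiable J f" "t \<in> interior_pts"
  shows "has_delta_derivative J f (delta_deriv J f t) t"
  using assms interior_pts_kappa[OF assms(2)] delta_deriv_J
  unfolding delta_differentiable_def by blast

lemma lipschitz_delta_deriv_sup:
  assumes f: "delta_differentiable J f" and M: "delta_deriv_sup T a b f \<le> ereal M"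
    and pq: "p \<in> J" "q \<in> J"
  shows "\<bar>f q - f p\<bar> \<le> M * \<bar>q - p\<bar>"
proof -
  have *: "\<bar>f q - f p\<bar> \<le> M * (q - p)" if pq: "p \<in> J" "q \<in> J" "p \<le> q" for p q
  proof (rule delta_mean_value[OF closed_J delta_differentiable_imp_continuous_on[OF f] pq])
    fix t assume t: "t \<in> J" "p < t \<or> (t = p \<and> p < fwd_jump J p)" "t < q"
    \<comment> \<open>If \<open>t = a\<close>, then also \<open>p = a\<close>, and \<open>a\<close>
      is right-scattered in \<open>J\<close>, hence in \<open>T\<close> by
      \<open>fwd_jump_interval\<close>.\<close>
    have "t \<in> interior_pts"
      using t J_bounds[OF pq(1)] J_bounds[OF pq(2)] ab fwd_jump_interval[OF ab(1,2), of a]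
      by (auto simp: interior_pts_def J_def)
    moreover from this have "ereal \<bar>delta_deriv J f t\<bar> \<le> delta_deriv_sup T a b f"
      unfolding delta_deriv_sup_eq by (rule SUP_upper)
    hence "\<bar>delta_deriv J f t\<bar> \<le> M" using M by (metis ereal_less_eq(3) order_trans)
    ultimately show "\<exists>D. has_delta_derivative J f D t \<and> \<bar>D\<bar> \<le> M"
      using has_delta_deriv_interior[OF f] by blast
  qed
  show ?thesis using *[OF pq] *[OF pq(2,1)] by (cases "p \<le> q") (auto simp: abs_minus_commute)
qed

text \<open>If the supremum is infinite, the inequality still says something when \<open>H = 0\<close>: uniform
  continuity then plays the role of the Lipschitz bound.\<close>

lemma err_eq_0:
  assumes cont: "continuous_on J f" and H: "H = 0"
  shows "err f = 0"
proof -
  have J: "compact J" unfolding J_def using T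
    by (intro compact_Int_closed) (auto simp: time_scale_def)
  hence unif: "uniformly_continuous_on J f" by (rule compact_uniformly_continuous[OF cont])
  have "bounded (f ` J)" by (intro compact_imp_bounded compact_continuous_image cont J)
  then obtain B where B: "\<And>v. v \<in> J \<Longrightarrow> \<bar>f v\<bar> \<le> B" unfolding bounded_iff by auto
  have B0: "0 \<le> B" using B[OF mem_J(1)] by linarith
  have "\<bar>err f\<bar> \<le> 0 + e" if e: "e > 0" for e
  proof -
    have "e / (b - a) > 0" using e ab by simp
    then obtain d where d: "d > 0" "\<And>p q. p \<in> J \<Longrightarrow> q \<in> J \<Longrightarrow> \<bar>q - p\<bar> < d \<Longrightarrow> \<bar>f q - f p\<bar> < e / (b - a)"
      using unif unfolding uniformly_continuous_on_def dist_real_def by meson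
    \<comment> \<open>Close points are handled by uniform continuity. For points at distance at
      least \<open>d\<close> the oscillation \<open>2 * B\<close> is absorbed by the slope
      \<open>2 * B / d\<close>, whose size is harmless because \<open>H = 0\<close>.\<close>
    have "\<bar>f q - f p\<bar> \<le> e / (b - a) + 2 * B / d * \<bar>q - p\<bar>" if pq: "p \<in> J" "q \<in> J" for p q
    proof (cases "\<bar>q - p\<bar> < d")
      case True
      moreover have "0 \<le> 2 * B / d * \<bar>q - p\<bar>" using B0 d(1) by simp
      ultimately show ?thesis using d(2)[OF pq] by linarith
    next
      case False
      have "\<bar>f q - f p\<bar> \<le> 2 * B / d * d" using B[OF pq(1)] B[OF pq(2)] d(1) by simp
      also have "\<dots> \<le> 2 * B / d * \<bar>q - p\<bar>" using False B0 d(1) by (intro mult_left_mono) auto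
      finally show ?thesis using \<open>e / (b - a) > 0\<close> by linarith
    qed
    from err_bound[OF cont this] show ?thesis using H ab by simp
  qed
  hence "\<bar>err f\<bar> \<le> 0" by (rule field_le_epsilon)
  thus ?thesis by simp
qed

lemma err_le:
  assumes f: "delta_differentiable J f"
  shows "ereal \<bar>err f\<bar> \<le> delta_deriv_sup T a b f * ereal H"
proof (cases "delta_deriv_sup T a b f")
  case (real M)
  have "\<bar>err f\<bar> \<le> 0 * (b - a) + M * H"
    using lipschitz_delta_deriv_sup[OF f, of M] real
    by (intro err_bound delta_differentiable_imp_continuous_on[OF f]) auto
  thus ?thesis using real by simp
next
  case PInf
  \<comment> \<open>In \<open>ereal\<close> infinity times 0 is 0, so \<open>H = 0\<close> requires
    a vanishing error; for positive \<open>H\<close> the right-hand side is infinite.\<close>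
  thus ?thesis using H_nonneg err_eq_0[OF delta_differentiable_imp_continuous_on[OF f]]
    by (cases "H = 0") (auto simp: zero_ereal_def[symmetric])
next
  case MInf
  thus ?thesis using delta_deriv_sup_nonneg[of f] by simp
qed

section \<open>Sharpness\<close>

text \<open>Serves to bring the supremum to a prescribed value exactly. The summand
  \<open>0 * f t\<close> fits \<open>has_delta_derivative_linear\<close>.\<close>

lemma delta_deriv_sup_scale:
  assumes f: "delta_differentiable J f" and m: "delta_deriv_sup T a b f = ereal m" and k: "0 \<le> k"
  shows "delta_deriv_sup T a b (\<lambda>t. k * f t + 0 * f t) = ereal (k * m)"
proof -
  have "delta_deriv J (\<lambda>t. k * f t + 0 * f t) t = k * delta_deriv J f t" if t: "t \<in> interior_pts" for t
  proof -
    note D = has_delta_deriv_interior[OF f t]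
    from delta_deriv_J[OF has_delta_derivative_linear[OF D D, where c = k and d = 0] interior_pts_kappa[OF t]]
    show ?thesis by simp
  qed
  hence "delta_deriv_sup T a b (\<lambda>t. k * f t + 0 * f t) = (SUP t\<in>interior_pts. ereal k * ereal \<bar>delta_deriv J f t\<bar>)"
    unfolding delta_deriv_sup_eq using k by (intro SUP_cong) (auto simp: abs_mult)
  also have "\<dots> = ereal k * (SUP t\<in>interior_pts. ereal \<bar>delta_deriv J f t\<bar>)"
    using k interior_pts_nonempty by (intro SUP_ereal_mult_left) auto
  finally show ?thesis using m unfolding delta_deriv_sup_eq by simp
qed

lemma ex_smooth_zigzag:
  assumes \<eta>: "\<eta> > 0"
  shows "\<exists>f. delta_differentiable J f \<and> delta_deriv_sup T a b f \<le> 1 \<and> (\<forall>t. \<bar>f t - zigzag t\<bar> \<le> 3 * \<eta>)"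
proof -
  define s where "s = (\<lambda>r. sqrt (r\<^sup>2 + \<eta>\<^sup>2))"
  define s' where "s' = (\<lambda>r. r / sqrt (r\<^sup>2 + \<eta>\<^sup>2))"
  define f where "f = (\<lambda>t. s (t - x) - s (t - \<alpha>) - s (t - \<beta>))"
  define f' where "f' = (\<lambda>t. s' (t - x) - s' (t - \<alpha>) - s' (t - \<beta>))"
  have pos: "r\<^sup>2 + \<eta>\<^sup>2 > 0" for r :: real using \<eta> by (simp add: add_nonneg_pos)
  have "((\<lambda>t. s (t - c)) has_real_derivative s' (t - c)) (at t)" for t c
    unfolding s_def s'_def using pos[of "t - c"]
    by (auto intro!: derivative_eq_intros simp: divide_simps)
  hence der: "(f has_real_derivative f' t) (at t)" for t
    unfolding f_def f'_def by (intro DERIV_diff)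
  have "\<bar>f' t\<bar> \<le> 1" for t
  proof -
    \<comment> \<open>The middle term lies between the other two, so \<open>f' t\<close> lies
      between \<open>- s' (t - \<alpha>)\<close> and \<open>- s' (t - \<beta>)\<close>. Thus
      smoothing does not push the slope beyond 1, although three terms of size up to 1 are
      added.\<close>
    have "s' (t - \<beta>) \<le> s' (t - x)" "s' (t - x) \<le> s' (t - \<alpha>)"
      unfolding s'_def using ordered by (auto intro!: mono_smooth_abs_deriv[OF \<eta>])
    moreover have "\<bar>s' (t - \<beta>)\<bar> \<le> 1" "\<bar>s' (t - \<alpha>)\<bar> \<le> 1"
      unfolding s'_def by (rule smooth_abs_deriv_le_1)+
    ultimately show ?thesis unfolding f'_def by linarith
  qed
  hence lip: "\<bar>f u - f v\<bar> \<le> 1 * \<bar>u - v\<bar>" for u v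
    using field_differentiable_bound[of UNIV f f' 1 u v] der by simp
  have diff: "delta_differentiable J f" by (rule has_real_derivative_imp_delta_differentiable[OF der])
  have "\<bar>delta_deriv J f t\<bar> \<le> 1" if t: "t \<in> interior_pts" for t
    using has_delta_derivative_lipschitz_bound[OF has_delta_deriv_interior[OF diff t] closed_J interior_pts_kappa[OF t]]
      J_other[of t] lip by blast
  hence "delta_deriv_sup T a b f \<le> 1"
    unfolding delta_deriv_sup_eq by (intro SUP_least) (simp add: one_ereal_def)
  moreover have "\<bar>f t - zigzag t\<bar> \<le> 3 * \<eta>" for t
  proof -
    define e where "e = (\<lambda>c. s (t - c) - \<bar>t - c\<bar>)"
    have "\<bar>e c\<bar> \<le> \<eta>" for c unfolding e_def s_def by (rule smooth_abs_approx[OF \<eta>])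
    from this[of x] this[of \<alpha>] this[of \<beta>] have "\<bar>e x - e \<alpha> - e \<beta>\<bar> \<le> 3 * \<eta>" by linarith
    moreover have "f t - zigzag t = e x - e \<alpha> - e \<beta>" by (simp add: f_def zigzag_def e_def)
    ultimately show ?thesis by simp
  qed
  ultimately show ?thesis using diff by blast
qed

lemma err_sharp:
  assumes M: "0 \<le> M"
    and R: "\<And>f. delta_differentiable J f \<Longrightarrow> delta_deriv_sup T a b f = ereal M \<Longrightarrow> \<bar>err f\<bar> \<le> R"
  shows "M * H \<le> R"
proof (cases "M = 0 \<or> H = 0")
  case True
  \<comment> \<open>Here only \<open>0 \<le> R\<close> is needed, and any function with supremum
    \<open>M\<close> yields it; a linear one has constant delta derivative.\<close>
  define f where "f = (\<lambda>t::real. M * t + 0 * t)"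
  have der: "has_delta_derivative J f M t" for t
    using has_delta_derivative_linear[OF has_delta_derivative_ident has_delta_derivative_ident, where c = M and d = 0]
    by (simp add: f_def)
  hence "delta_differentiable J f" unfolding delta_differentiable_def by blast
  moreover have "delta_deriv_sup T a b f = ereal M"
    unfolding delta_deriv_sup_eq using delta_deriv_J[OF der] interior_pts_kappa M interior_pts_nonempty by simp
  ultimately have "\<bar>err f\<bar> \<le> R" by (rule R)
  hence "0 \<le> R" by linarith
  thus ?thesis using True by auto
next
  case False
  hence pos: "M > 0" "H > 0" using M H_nonneg by auto
  show ?thesis
  proof (rule field_le_epsilon)
    fix e :: real assume e: "e > 0"
    \<comment> \<open>Being below \<open>H\<close>, \<open>d\<close> leaves a positive error after
      smoothing; \<open>M * d \<le> e\<close> limits the final loss.\<close>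
    define d where "d = min (H / 2) (e / M)"
    \<comment> \<open>Smoothing moves values by at most \<open>3 * \<eta>\<close>, hence differences
      of values by \<open>6 * \<eta>\<close>; integrated over \<open>[a, b]\<close> this amounts to
      \<open>d\<close>.\<close>
    define \<eta> where "\<eta> = d / 6 / (b - a)"
    have d: "d > 0" "d < H" "M * d \<le> e"
      using e pos by (auto simp: d_def min_def field_simps)
    have \<eta>: "\<eta> > 0" using d ab by (simp add: \<eta>_def)
    have "b - a \<noteq> 0" using ab by simp
    hence \<eta>_ab: "\<eta> * (b - a) = d / 6" using nonzero_eq_divide_eq \<eta>_def by blast
    obtain f where f: "delta_differentiable J f" "delta_deriv_sup T a b f \<le> 1" "\<And>t. \<bar>f t - zigzag t\<bar> \<le> 3 * \<eta>"
      using ex_smooth_zigzag[OF \<eta>] by blast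
    have cf: "continuous_on J f" by (rule delta_differentiable_imp_continuous_on[OF f(1)])
    have cz: "continuous_on J zigzag" unfolding zigzag_def by (intro continuous_intros)
    have "\<bar>err (\<lambda>t. 1 * f t + (- 1) * zigzag t)\<bar> \<le> 6 * \<eta> * (b - a) + 0 * H"
    proof (rule err_bound)
      show "continuous_on J (\<lambda>t. 1 * f t + (- 1) * zigzag t)" by (intro continuous_intros cf cz)
      show "\<bar>1 * f q + (- 1) * zigzag q - (1 * f p + (- 1) * zigzag p)\<bar> \<le> 6 * \<eta> + 0 * \<bar>q - p\<bar>" for p q
        using f(3)[of p] f(3)[of q] by linarith
    qed
    also have "\<dots> = d" using \<eta>_ab by (simp only: mult.assoc)
    finally have "\<bar>err f - H\<bar> \<le> d" unfolding err_linear[OF cf cz] err_zigzag by simp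
    hence v: "err f \<ge> H - d" by linarith
    obtain m where m: "delta_deriv_sup T a b f = ereal m" "0 \<le> m" "m \<le> 1"
      using delta_deriv_sup_nonneg[of f] f(2) by (cases "delta_deriv_sup T a b f") (auto simp: one_ereal_def)
    have "\<bar>err f\<bar> \<le> m * H" using err_le[OF f(1)] m(1) by simp
    \<comment> \<open>With \<open>m = 0\<close> the inequality already proved would force the error
      to vanish, but it is at least \<open>H - d > 0\<close>.\<close>
    hence "m \<noteq> 0" using v d by auto
    hence m0: "m > 0" using m by simp
    \<comment> \<open>The rescaling makes the supremum exactly \<open>M\<close>. As
      \<open>m \<le> 1\<close>, the factor is at least \<open>M\<close>, so the error is still at
      least \<open>M * (H - d)\<close>.\<close>
    define g where "g = (\<lambda>t. M / m * f t + 0 * f t)"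
    have "delta_deriv_sup T a b g = ereal M"
      unfolding g_def using delta_deriv_sup_scale[OF f(1) m(1), of "M / m"] m0 pos by simp
    moreover have "delta_differentiable J g"
      using f(1) has_delta_derivative_linear unfolding delta_differentiable_def g_def by meson
    ultimately have "\<bar>err g\<bar> \<le> R" by (intro R)
    moreover have "err g = M / m * err f" unfolding g_def err_linear[OF cf cf] by simp
    moreover have "M * (H - d) \<le> M / m * err f"
      using v pos m0 m(3) d by (intro mult_mono) (auto simp: field_simps)
    moreover have "M * (H - d) \<ge> M * H - e" using d(3) by (simp add: algebra_simps)
    ultimately show "M * H \<le> R + e" by linarith
  qed
qed

end

text \<open>Sharpness is taken as optimality for every prescribed finite value of the supremum, with
  the time scale and all nodes fixed, rather than for one special configuration.\<close>

theorem proposition3: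
  fixes T :: "real set" and a b x \<alpha>\<^sub>1 \<alpha>\<^sub>2 :: real
  assumes "time_scale T"
    and "a \<in> T" and "b \<in> T" and "a < b"
    and "x \<in> {a..b} \<inter> T"
    and "\<alpha>\<^sub>1 \<in> {a..x} \<inter> T"
    and "\<alpha>\<^sub>2 \<in> {x..b} \<inter> T"
  shows
    "let J = {a..b} \<inter> T;
         E = (\<lambda>f::real \<Rightarrow> real.
               \<bar>delta_integral J a b (\<lambda>t. f (fwd_jump J t))
                 - ((\<alpha>\<^sub>1 - a) * f a + (\<alpha>\<^sub>2 - \<alpha>\<^sub>1) * f x + (b - \<alpha>\<^sub>2) * f b)\<bar>);
         H = ts_h T 2 a \<alpha>\<^sub>1 + ts_h T 2 x \<alpha>\<^sub>1 + ts_h T 2 x \<alpha>\<^sub>2 + ts_h T 2 b \<alpha>\<^sub>2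
     in (\<forall>f. delta_differentiable J f \<longrightarrow> ereal (E f) \<le> delta_deriv_sup T a b f * ereal H) \<and>
        (\<forall>M\<ge>0. \<forall>R. (\<forall>f. delta_differentiable J f \<and> delta_deriv_sup T a b f = ereal M \<longrightarrow> E f \<le> R)
               \<longrightarrow> M * H \<le> R)"
proof -
  interpret quadrature T a b x \<alpha>\<^sub>1 \<alpha>\<^sub>2
    by unfold_locales (use assms in auto)
  note err = err_eq[OF delta_differentiable_imp_continuous_on, symmetric]
  show ?thesis
    unfolding Let_def J_def[symmetric] H_def[symmetric]
    using err_le err_sharp by (auto simp: err)
qed

end
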